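(* Let $\Omega=\bigcup_{j=1}^N\Omega_j$ be a domain with $N_{\max}$ layers. Then $$\|T^{N_{\max}+1}\|_{\mathrm{OP},\infty}<1 .$$
   Context: **Geometry.** $N>1$, and $\Omega_1,\dots,\Omega_N\subset\mathbb R^2$ are open disks of radii $r_i>0$ such that $\Omega=\bigcup_{i=1}^N\Omega_i$ is connected and at least two of the disks intersect. Standing assumptions: (A1) if $\Omega_i\cap\Omega_j\neq\emptyset$ ($i\ne j$), there are sets of positive (arclength) measure $\Gamma_i\subset\partial\Omega_i\cap\Omega_j$ and $\Gamma_j\subset\partial\Omega_j\cap\Omega_i$ with $\Gamma_i\cap\Omega_k=\emptyset=\Gamma_j\cap\Omega_k$ for all $k\in\{1,\dots,N\}\setminus\{i,j\}$; (A2) $\Omega_{i_1}\cap\Omega_{i_2}\cap\Omega_{i_3}\cap\Omega_{i_4}=\emptyset$ for all distinct $i_1,i_2,i_3,i_4$. **Boundaries and skeletons.** For each $j$: $\Gamma_j^{\rm ext}=\partial\Omega_j\cap\partial\Omega$, $\Gamma_j^{\rm int}=\overline{\partial\Omega_j\setminus\Gamma_j^{\rm ext}}$, $N_j=\{i\ne j:\Omega_i\cap\Omega_j\ne\emptyset\}$, and for $k\in N_j$, $N_{jk}=(N_j\cap N_k)\cup\{0\}$. For $k\in N_j$, $i\in N_{jk}$ (interiors relative to $\partial\Omega_j$): $\Gamma_j^{k,i}={\rm int}\{x\in\partial\Omega_j: x\in\Omega_k\cap\Omega_i\}$ if $i\neq0$, and $\Gamma_j^{k,0}={\rm int}\{x\in\partial\Omega_j: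 x\in\Omega_k,\ x\notin\Omega_\ell\ \forall \ell\in N_j\setminus\{k\}\}$. For $k\in N_j$: $\mathcal S_{j,k}=\overline{\bigcup_{i\in N_{jk}}\Gamma_k^{j,i}}$ (the part of $\partial\Omega_k$ lying in $\overline{\Omega_j}$, obtained as the closure of the part in $\Omega_j$) and $\mathcal S^{\rm int}_{j,k}=\mathcal S_{j,k}\setminus\partial\Omega_j$. The skeleton and interior skeleton of $\Omega_j$ are $\mathcal S_j=\bigcup_{k\in N_j}\mathcal S_{j,k}$ and $\mathcal S_j^{\rm int}=\bigcup_{k\in N_j}\mathcal S_{j,k}^{\rm int}$. For $\mathbf v=(\mathbf v_1,\dots,\mathbf v_N)$ with $\mathbf v_j\in L^\infty(\mathcal S_j)$ (arclength measure), $\|\mathbf v\|_\infty=\max_j{\rm ess\,sup}_{\mathcal S_j}|\mathbf v_j|$. **Partition of unity.** Fixed functions $\chi_j^k:\partial\Omega_j\to\mathbb R$ ($k\in N_j$), continuous on ${\rm int}(\Gamma_j^{\rm int})$ (interior relative to $\partial\Omega_j$), with $\chi_j^k=1$ on $\overline{\Gamma_j^{k,0}}\setminus\Gamma_j^{\rm ext}$, $\chi_j^k\in[0,1]$ on $\overline{\Gamma_j^{k,i}}\setminus\Gamma_j^{\rm ext}$ for $0\ne i\in N_{jk}$, $\chi_j^k=0$ otherwise, and $\sum_{k\in N_j}\chi_j^k=1$ on ${\rm int}(\Gamma_j^{\rm int})$. (If $\Gamma_j^{\rm ext}$ has an isolated point, the prescription at that point is modified by making at least one $\chi_j^k$ nonzero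 there, keeping the continuity requirement.) **Iteration operator.** For a non-empty open $\Gamma_j\subseteq\partial\Omega_j$ and $\lambda\in L^2(\Gamma_j)$, $\mathcal E_j(\lambda)\in C^0(\Omega_j)$ is the harmonic extension (Poisson integral): the solution of $\Delta w=0$ in $\Omega_j$, $w=\lambda$ on $\Gamma_j$, $w=0$ on $\partial\Omega_j\setminus\Gamma_j$. $\mathcal R_j(w)=w|_{\mathcal S_j}$ is the restriction to $\mathcal S_j$ (for $w$ continuous in $\Omega_j$ with piecewise continuous values on $\partial\Omega_j$). $T=(T_{ij})_{i,j=1}^N$ has $T_{ij}=P_{ij}$ if $j\in N_i$ and $T_{ij}=0$ otherwise, where $P_{ij}\mathbf v_j=\mathcal R_i(\mathcal E_i(\mathbf v_j|_{\mathcal S_{j,i}}\,\chi_i^j|_{\mathcal S_{j,i}}))$. Thus $(T\mathbf v)_i=\sum_{j\in N_i}P_{ij}\mathbf v_j$; $T$ acts on families $\mathbf v$ with $\mathbf v_j\in C^0(\mathcal S_j^{\rm int})\cap L^\infty(\mathcal S_j)$. For $n\in\mathbb N$, $$\|T^n\|_{\mathrm{OP},\infty}:=\sup\{\|T^n\mathbf v\|_\infty:\ \mathbf v\in\textstyle\prod_{j=1}^NC^0(\mathcal S_j^{\rm int}),\ \|\mathbf v\|_\infty=1\}.$$ **Layers.** The graph of $\Omega$ has vertices $\mathcal V=\{1,\dots,N\}$ and edges $\{(i,j):j\in N_i\}$; $i$ is a boundary node if $\partial\Omega_i\cap\partial\Omega$ has positive measure. $\mathcal L_1$ is the set of boundary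 nodes. For $m>1$, let $\mathcal W_m=\mathcal V\setminus\bigcup_{k<m}\mathcal L_k$; if $\mathcal W_m\neq\emptyset$, $\mathcal L_m$ is the set of boundary nodes of the graph on $\mathcal W_m$, i.e. of $i\in\mathcal W_m$ such that $\partial\Omega_i\cap\partial(\bigcup_{\ell\in\mathcal W_m}\Omega_\ell)$ has positive measure. $N_{\max}$ is the total number of layers. *)

theory Defs
  imports "HOL-Probability.Essential_Supremum"
begin

text \<open>The plane is modelled by the type \<^typ>\<open>complex\<close>.\<close>

definition circle_arclength :: "complex \<Rightarrow> real \<Rightarrow> complex measure" where
  "circle_arclength a \<rho> =
     scale_measure (ennreal \<rho>)
       (distr (restrict_space lborel {0..<2 * pi}) borel (\<lambda>t. a + of_real \<rho> * cis t))"

lemma sets_circle_arclength [simp, measurable_cong]: "sets (circle_arclength a \<rho>) = sets borel"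
  and space_circle_arclength [simp]: "space (circle_arclength a \<rho>) = UNIV"
  by (simp_all add: circle_arclength_def space_scale_measure)

text \<open>
  The index of a disk ranges over \<open>{1..N}\<close>, which leaves \<open>0\<close> free as the dummy index in
  \<open>nbrs2\<close> and \<open>Gam\<close>.
\<close>

locale disk_family =
  fixes N :: nat and c :: "nat \<Rightarrow> complex" and r :: "nat \<Rightarrow> real"
begin

definition disk :: "nat \<Rightarrow> complex set" where
  "disk j = ball (c j) (r j)"

definition \<Omega> :: "complex set" where
  "\<Omega> = (\<Union>j\<in>{1..N}. disk j)"

definition arclength :: "nat \<Rightarrow> complex measure" where
  "arclength j = circle_arclength (c j) (r j)"

lemma sets_arclength [simp, measurable_cong]: "sets (arclength j) = sets borel"
  and space_arclength [simp]: "space (arclength j) = UNIV"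
  by (simp_all add: arclength_def)

definition rel_int :: "nat \<Rightarrow> complex set \<Rightarrow> complex set" where
  "rel_int j A = top_of_set (frontier (disk j)) interior_of A"

definition Gam_ext :: "nat \<Rightarrow> complex set" where
  "Gam_ext j = frontier (disk j) \<inter> frontier \<Omega>"

definition Gam_int :: "nat \<Rightarrow> complex set" where
  "Gam_int j = closure (frontier (disk j) - Gam_ext j)"

definition nbrs :: "nat \<Rightarrow> nat set" where
  "nbrs j = {i \<in> {1..N}. i \<noteq> j \<and> disk i \<inter> disk j \<noteq> {}}"

definition nbrs2 :: "nat \<Rightarrow> nat \<Rightarrow> nat set" where
  "nbrs2 j k = (nbrs j \<inter> nbrs k) \<union> {0}"

text \<open>\<open>Gam j k i\<close> is $\Gamma_j^{k,i}$.\<close>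

definition Gam :: "nat \<Rightarrow> nat \<Rightarrow> nat \<Rightarrow> complex set" where
  "Gam j k i =
     (if i \<noteq> 0
      then rel_int j {x \<in> frontier (disk j). x \<in> disk k \<inter> disk i}
      else rel_int j {x \<in> frontier (disk j). x \<in> disk k \<and> (\<forall>l\<in>nbrs j - {k}. x \<notin> disk l)})"

text \<open>\<open>Skel2 j k\<close> is $\mathcal S_{j,k}$; it lies on the boundary of disk \<open>k\<close>, not of disk \<open>j\<close>.\<close>

definition Skel2 :: "nat \<Rightarrow> nat \<Rightarrow> complex set" where
  "Skel2 j k = closure (\<Union>i\<in>nbrs2 j k. Gam k j i)"

definition Skel2_int :: "nat \<Rightarrow> nat \<Rightarrow> complex set" where
  "Skel2_int j k = Skel2 j k - frontier (disk j)"

definition Skel :: "nat \<Rightarrow> complex set" where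
  "Skel j = (\<Union>k\<in>nbrs j. Skel2 j k)"

definition Skel_int :: "nat \<Rightarrow> complex set" where
  "Skel_int j = (\<Union>k\<in>nbrs j. Skel2_int j k)"

text \<open>
  Arclength on the union of all the circles. Summing over the circles does not count anything
  twice, since distinct circles meet in at most two points (and assumption \<open>A1\<close> below forces
  the circles to be distinct).
\<close>

definition arclength_all :: "complex measure" where
  "arclength_all =
     measure_of UNIV (sets borel) (\<lambda>A. \<Sum>k\<in>{1..N}. emeasure (arclength k) A)"

lemma sets_arclength_all [simp, measurable_cong]: "sets arclength_all = sets borel"
  and space_arclength_all [simp]: "space arclength_all = UNIV"
  using sets.space_closed[of "borel :: complex measure"]
  by (simp_all add: arclength_all_def sets.sigma_sets_eq[of "borel :: complex measure", simplified])

lemma emeasure_arclength_all: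
  assumes "A \<in> sets borel"
  shows "emeasure arclength_all A = (\<Sum>k\<in>{1..N}. emeasure (arclength k) A)"
proof (rule emeasure_measure_of[OF arclength_all_def])
  show "countably_additive (sets arclength_all) (\<lambda>A. \<Sum>k\<in>{1..N}. emeasure (arclength k) A)"
  proof (rule countably_additiveI)
    fix B :: "nat \<Rightarrow> complex set"
    assume B: "range B \<subseteq> sets arclength_all" "disjoint_family B"
    have "(\<Sum>i. \<Sum>k\<in>{1..N}. emeasure (arclength k) (B i))
        = (\<Sum>k\<in>{1..N}. \<Sum>i. emeasure (arclength k) (B i))"
      by (rule suminf_sum) simp
    also have "\<dots> = (\<Sum>k\<in>{1..N}. emeasure (arclength k) (\<Union>i. B i))"
      using B by (intro sum.cong suminf_emeasure refl) auto
    finally show "(\<Sum>i. \<Sum>k\<in>{1..N}. emeasure (arclength k) (B i))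
        = (\<Sum>k\<in>{1..N}. emeasure (arclength k) (\<Union>i. B i))" .
  qed
qed (use assms in \<open>auto simp: positive_def\<close>)

text \<open>
  A family \<open>v\<close> has components \<open>v j :: complex \<Rightarrow> real\<close>, of which only the values on \<open>Skel j\<close> matter.
\<close>

definition sup_norm :: "(nat \<Rightarrow> complex \<Rightarrow> real) \<Rightarrow> ennreal" where
  "sup_norm v =
     (MAX j\<in>{1..N}. esssup (restrict_space arclength_all (Skel j)) (\<lambda>x. ennreal \<bar>v j x\<bar>))"

text \<open>
  \<open>harm_ext j G g\<close> is the harmonic extension to disk \<open>j\<close> of the boundary datum that equals \<open>g\<close>
  on \<open>G\<close> and \<open>0\<close> on the rest of the boundary circle: the Poisson integral inside the disk, the
  datum itself on the circle.
\<close>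

definition harm_ext :: "nat \<Rightarrow> complex set \<Rightarrow> (complex \<Rightarrow> real) \<Rightarrow> complex \<Rightarrow> real" where
  "harm_ext j G g x =
     (if x \<in> disk j
      then 1 / (2 * pi * r j) *
        (LINT y|arclength j. ((r j)\<^sup>2 - (norm (x - c j))\<^sup>2) / (norm (x - y))\<^sup>2 * (indicator G y * g y))
      else indicator G x * g x)"

text \<open>
  \<open>chi j k\<close> is $\chi_j^k$, of which only the values on the boundary of disk \<open>j\<close> matter. The
  restriction to \<open>Skel i\<close> is rendered by extension by zero.
\<close>

definition P :: "(nat \<Rightarrow> nat \<Rightarrow> complex \<Rightarrow> real) \<Rightarrow> nat \<Rightarrow> nat \<Rightarrow> (complex \<Rightarrow> real) \<Rightarrow> complex \<Rightarrow> real" where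
  "P chi i j w x =
     (if x \<in> Skel i then harm_ext i (Skel2 j i) (\<lambda>y. w y * chi i j y) x else 0)"

definition T :: "(nat \<Rightarrow> nat \<Rightarrow> complex \<Rightarrow> real) \<Rightarrow> (nat \<Rightarrow> complex \<Rightarrow> real) \<Rightarrow> nat \<Rightarrow> complex \<Rightarrow> real" where
  "T chi v i x = (\<Sum>j\<in>nbrs i. P chi i j (v j) x)"

definition op_norm :: "((nat \<Rightarrow> complex \<Rightarrow> real) \<Rightarrow> nat \<Rightarrow> complex \<Rightarrow> real) \<Rightarrow> ennreal" where
  "op_norm A =
     (SUP v\<in>{v. (\<forall>j\<in>{1..N}. continuous_on (Skel_int j) (v j)) \<and> sup_norm v = 1}. sup_norm (A v))"

definition boundary_nodes :: "nat set \<Rightarrow> nat set" where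
  "boundary_nodes W =
     {i \<in> W. 0 < emeasure (arclength i) (frontier (disk i) \<inter> frontier (\<Union>l\<in>W. disk l))}"

fun layer :: "nat \<Rightarrow> nat set" where
  "layer m = boundary_nodes ({1..N} - (\<Union>k\<in>{1..<m}. layer k))"

declare layer.simps [simp del]

definition num_layers :: nat where
  "num_layers = card {m. 1 \<le> m \<and> {1..N} - (\<Union>k\<in>{1..<m}. layer k) \<noteq> {}}"

end

locale disk_domain = disk_family +
  assumes N_gt_1: "1 < N"
    and r_pos: "\<And>i. i \<in> {1..N} \<Longrightarrow> 0 < r i"
    and connected_\<Omega>: "connected \<Omega>"
    and some_intersect: "\<exists>i\<in>{1..N}. \<exists>j\<in>{1..N}. i \<noteq> j \<and> disk i \<inter> disk j \<noteq> {}"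
    and A1: "\<And>i j. i \<in> {1..N} \<Longrightarrow> j \<in> {1..N} \<Longrightarrow> i \<noteq> j \<Longrightarrow> disk i \<inter> disk j \<noteq> {} \<Longrightarrow>
      \<exists>Gi Gj. Gi \<subseteq> frontier (disk i) \<inter> disk j \<and> 0 < emeasure (arclength i) Gi \<and>
              Gj \<subseteq> frontier (disk j) \<inter> disk i \<and> 0 < emeasure (arclength j) Gj \<and>
              (\<forall>k\<in>{1..N} - {i, j}. Gi \<inter> disk k = {} \<and> Gj \<inter> disk k = {})"
    and A2: "\<And>i1 i2 i3 i4. {i1, i2, i3, i4} \<subseteq> {1..N} \<Longrightarrow> distinct [i1, i2, i3, i4] \<Longrightarrow>
      disk i1 \<inter> disk i2 \<inter> disk i3 \<inter> disk i4 = {}"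

text \<open>
  At an isolated point of \<open>Gam_ext j\<close> the value \<open>0\<close> that would be prescribed there is given up,
  while continuity is required at that point too (it is an interior point of \<open>Gam_int j\<close>).
\<close>

locale disk_partition_of_unity = disk_domain +
  fixes chi :: "nat \<Rightarrow> nat \<Rightarrow> complex \<Rightarrow> real"
  assumes chi_continuous: "\<And>j k. j \<in> {1..N} \<Longrightarrow> k \<in> nbrs j \<Longrightarrow>
      continuous_on (rel_int j (Gam_int j)) (chi j k)"
    and chi_one: "\<And>j k x. j \<in> {1..N} \<Longrightarrow> k \<in> nbrs j \<Longrightarrow>
      x \<in> closure (Gam j k 0) - Gam_ext j \<Longrightarrow> chi j k x = 1"
    and chi_range: "\<And>j k i x. j \<in> {1..N} \<Longrightarrow> k \<in> nbrs j \<Longrightarrow> i \<in> nbrs2 j k \<Longrightarrow> i \<noteq> 0 \<Longrightarrow>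
      x \<in> closure (Gam j k i) - Gam_ext j \<Longrightarrow> chi j k x \<in> {0..1}"
    and chi_zero: "\<And>j k x. j \<in> {1..N} \<Longrightarrow> k \<in> nbrs j \<Longrightarrow> x \<in> frontier (disk j) \<Longrightarrow>
      \<not> x isolated_in Gam_ext j \<Longrightarrow>
      x \<notin> (\<Union>i\<in>nbrs2 j k. closure (Gam j k i) - Gam_ext j) \<Longrightarrow> chi j k x = 0"
    and chi_isolated: "\<And>j x. j \<in> {1..N} \<Longrightarrow> x isolated_in Gam_ext j \<Longrightarrow>
      \<exists>k\<in>nbrs j. chi j k x \<noteq> 0"
    and chi_sum: "\<And>j x. j \<in> {1..N} \<Longrightarrow> x \<in> rel_int j (Gam_int j) \<Longrightarrow>
      (\<Sum>k\<in>nbrs j. chi j k x) = 1"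

end

theory Submission
  imports Defs "HOL-Complex_Analysis.Complex_Analysis"
begin

text \<open>
  If every component of the argument is replaced by the constant 1, the iteration produces
  functions that do not depend on the argument any more: \<open>majorant 0\<close> is 1, and
  \<open>majorant (n + 1) i\<close> is the Poisson integral over the \<open>i\<close>th circle of the sum of
  \<open>chi i j * majorant n j\<close> over the neighbours \<open>j\<close>. The functions \<open>chi i j\<close> are nonnegative and
  add up to 1 wherever the circle is covered, so all majorants lie between 0 and 1, and
  \<open>majorant n i\<close> bounds the \<open>i\<close>th component of $T^n \mathbf v$ almost everywhere on the
  skeleton whenever $\|\mathbf v\|_\infty \le 1$ (\<open>dominated_T\<close>). It remains to bound
  \<open>majorant (num_layers + 1)\<close> away from 1 on the skeletons.

  Pointwise strictness comes from the maximum principle: a Poisson integral of a datum bounded by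
  1 is below 1 throughout the disk as soon as the datum is below 1 on a set of positive arclength
  (\<open>poisson_less_1\<close>). For a disk of layer \<open>m\<close> such a set appears after \<open>m\<close> steps, because a part
  of its circle of positive length meets no disk of the layers from \<open>m\<close> on, and there only
  majorants from earlier layers enter the datum (\<open>majorant_less_1_on_layer\<close>). Every disk belongs
  to some layer, hence \<open>majorant num_layers\<close> is below 1 in all disks.

  One more step makes this uniform. The skeleton of disk \<open>i\<close> consists of arcs of other circles
  inside disk \<open>i\<close>, and compactness can only fail at their end points, where two circles cross. By
  (A1) the crossing is transversal. A point approaching the crossing \<open>p\<close> along the arc of the
  other circle therefore sees either side of \<open>p\<close> on circle \<open>i\<close> with harmonic measure bounded from
  below, and it suffices that the datum is at most \<open>1 - e\<close> near \<open>p\<close> on one of the two sides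
  (\<open>poisson_gap_near_crossing\<close>). If one side is locally covered by no disk, the datum vanishes on
  it. Otherwise \<open>p\<close> is an interior point of the inner boundary, where the functions \<open>chi i j\<close> are
  continuous. If \<open>p\<close> is not in disk \<open>j\<close>, then \<open>chi i j\<close> vanishes on a side of \<open>p\<close> that lies outside
  of disk \<open>j\<close>, hence also at \<open>p\<close>. So only disks that contain \<open>p\<close> contribute at \<open>p\<close>, and their
  majorants are continuous and below 1 there (\<open>datum_gap_near_interior_point\<close>).
\<close>

section \<open>The Poisson integral of a disk\<close>

definition poisson_kernel :: "complex \<Rightarrow> real \<Rightarrow> complex \<Rightarrow> complex \<Rightarrow> real" where
  "poisson_kernel a \<rho> x y = (\<rho>\<^sup>2 - (norm (x - a))\<^sup>2) / (norm (x - y))\<^sup>2"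

definition poisson :: "complex \<Rightarrow> real \<Rightarrow> (complex \<Rightarrow> real) \<Rightarrow> complex \<Rightarrow> real" where
  "poisson a \<rho> g x =
     1 / (2 * pi * \<rho>) * (LINT y|circle_arclength a \<rho>. poisson_kernel a \<rho> x y * g y)"

lemma measurable_circle_param [measurable]:
  "(\<lambda>t. a + of_real \<rho> * cis t) \<in> borel_measurable borel"
  by (intro borel_measurable_continuous_onI continuous_intros)

lemma circle_arclength_eq_density:
  "circle_arclength a \<rho> =
     density (distr (restrict_space lborel {0..<2 * pi}) borel (\<lambda>t. a + of_real \<rho> * cis t))
       (\<lambda>_. ennreal \<rho>)"
  by (rule measure_eqI) (simp_all add: circle_arclength_def emeasure_density_const)

lemma integral_circle_arclength:
  fixes g :: "complex \<Rightarrow> real"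
  assumes "0 \<le> \<rho>" and [measurable]: "g \<in> borel_measurable borel"
  shows "(LINT y|circle_arclength a \<rho>. g y) =
           \<rho> * (LINT t:{0..<2 * pi}|lborel. g (a + of_real \<rho> * cis t))"
  unfolding circle_arclength_eq_density set_lebesgue_integral_def using assms(1)
  by (simp add: integral_density integral_distr integral_restrict_space measurable_restrict_space1)

lemma emeasure_circle_arclength:
  assumes [measurable]: "A \<in> sets borel"
  shows "emeasure (circle_arclength a \<rho>) A =
           ennreal \<rho> * emeasure lborel {t \<in> {0..<2 * pi}. a + of_real \<rho> * cis t \<in> A}"
proof -
  have "(\<lambda>t. a + of_real \<rho> * cis t) -` A \<inter> {0..<2 * pi} = {t \<in> {0..<2 * pi}. a + of_real \<rho> * cis t \<in> A}"
    by auto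
  moreover have "emeasure (circle_arclength a \<rho>) A = ennreal \<rho> *
      emeasure (restrict_space lborel {0..<2 * pi}) ((\<lambda>t. a + of_real \<rho> * cis t) -` A \<inter> {0..<2 * pi})"
    unfolding circle_arclength_def
    by (simp add: emeasure_distr measurable_restrict_space1 space_restrict_space)
  ultimately show ?thesis
    by (simp add: emeasure_restrict_space del: atLeastLessThan_iff)
qed

lemma finite_measure_circle_arclength: "finite_measure (circle_arclength a \<rho>)"
proof (rule finite_measureI)
  have "{t \<in> {0..<2 * pi}. a + of_real \<rho> * cis t \<in> UNIV} = {0..<2 * pi}"
    by auto
  then show "emeasure (circle_arclength a \<rho>) (space (circle_arclength a \<rho>)) \<noteq> \<infinity>"
    by (simp add: emeasure_circle_arclength ennreal_mult_eq_top_iff)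
qed

lemma AE_circle_arclength_sphere:
  assumes "0 < \<rho>"
  shows "AE y in circle_arclength a \<rho>. y \<in> sphere a \<rho>"
proof (rule AE_I)
  have *: "{t \<in> {0..<2 * pi}. a + of_real \<rho> * cis t \<in> - sphere a \<rho>} = {}"
    using assms by (auto simp: dist_norm norm_mult)
  have "- sphere a \<rho> \<in> sets borel"
    by (intro borel_open open_Compl closed_sphere)
  from emeasure_circle_arclength[OF this, of a \<rho>]
  show "emeasure (circle_arclength a \<rho>) (- sphere a \<rho>) = 0"
    unfolding * by simp
qed auto

lemma AE_circle_arclength_notin_finite:
  assumes "0 < \<rho>" "finite F"
  shows "AE y in circle_arclength a \<rho>. y \<notin> F"
proof (rule AE_I)
  have inj: "inj_on (\<lambda>t. a + of_real \<rho> * cis t) {0..<2 * pi}"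
  proof (rule inj_onI)
    fix s t assume st: "s \<in> {0..<2 * pi}" "t \<in> {0..<2 * pi}"
      and "a + of_real \<rho> * cis s = a + of_real \<rho> * cis t"
    then have "sin s = sin t" "cos s = cos t"
      using assms by (auto simp: complex_eq_iff)
    then have "\<exists>n :: int. s = t + 2 * pi * n"
      using sin_cos_eq_iff[of s t] by auto
    then obtain n :: int where n: "s = t + 2 * pi * n"
      by blast
    have "n < 1"
    proof (rule ccontr)
      assume "\<not> n < 1"
      then have "2 * pi * 1 \<le> 2 * pi * n"
        by (intro mult_left_mono) auto
      then show False
        using st n unfolding atLeastLessThan_iff by linarith
    qed
    moreover have "- 1 < n"
    proof (rule ccontr)
      assume "\<not> - 1 < n"
      then have "2 * pi * n \<le> 2 * pi * (- 1)"
        by (intro mult_left_mono) auto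
      then show False
        using st n unfolding atLeastLessThan_iff by linarith
    qed
    ultimately have "n = 0"
      by linarith
    then show "s = t"
      using n by simp
  qed
  have "finite ((\<lambda>t. a + of_real \<rho> * cis t) -` F \<inter> {0..<2 * pi})"
    using assms(2) inj by (rule finite_vimage_IntI)
  moreover have "{t \<in> {0..<2 * pi}. a + of_real \<rho> * cis t \<in> F} =
      (\<lambda>t. a + of_real \<rho> * cis t) -` F \<inter> {0..<2 * pi}"
    by auto
  ultimately have "emeasure lborel {t \<in> {0..<2 * pi}. a + of_real \<rho> * cis t \<in> F} = 0"
    by (metis emeasure_lborel_countable uncountable_infinite)
  then show "emeasure (circle_arclength a \<rho>) F = 0"
    using assms(2) by (simp add: emeasure_circle_arclength finite_imp_closed borel_closed)
qed (use assms in \<open>auto intro: finite_imp_closed borel_closed\<close>)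

lemma circle_param_right:
  assumes "norm (p - a) = \<rho>"
  obtains t where "0 \<le> t" "t < 2 * pi" "p = a + of_real \<rho> * cis t"
proof
  show "p = a + of_real \<rho> * cis (Arg2pi (p - a))"
    using Arg2pi_eq[of "p - a"] assms by (simp add: cis_conv_exp mult.commute)
qed (use Arg2pi_ge_0 Arg2pi_lt_2pi in auto)

lemma emeasure_circle_arclength_pos:
  assumes \<rho>: "0 < \<rho>" and V: "open V" "p \<in> V" "p \<in> sphere a \<rho>" and A: "V \<inter> sphere a \<rho> \<subseteq> A" "A \<in> sets borel"
  shows "0 < emeasure (circle_arclength a \<rho>) A"
proof -
  have "norm (p - a) = \<rho>"
    using V by (simp add: dist_norm norm_minus_commute)
  then obtain t0 where t0: "0 \<le> t0" "t0 < 2 * pi" "p = a + of_real \<rho> * cis t0"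
    by (rule circle_param_right)
  have "isCont (\<lambda>t. a + of_real \<rho> * cis t) t0"
    by (simp add: cis_conv_exp)
  then have "eventually (\<lambda>t. a + of_real \<rho> * cis t \<in> V) (at t0)"
    using V t0 by (simp add: isCont_def tendsto_def)
  then have "eventually (\<lambda>t. a + of_real \<rho> * cis t \<in> V) (at_right t0)"
    by (simp add: eventually_at_split)
  then obtain b where b: "b > t0" "\<And>t. t0 < t \<Longrightarrow> t < b \<Longrightarrow> a + of_real \<rho> * cis t \<in> V"
    by (auto simp: eventually_at_right[of t0 "t0 + 1"])
  define e where "e = min b (2 * pi)"
  have e: "t0 < e"
    using b t0 by (auto simp: e_def)
  have "{t0<..<e} \<subseteq> {t \<in> {0..<2 * pi}. a + of_real \<rho> * cis t \<in> A}"
    using b t0 A \<rho> by (force simp: e_def dist_norm norm_mult)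
  then have "emeasure lborel {t0<..<e} \<le> emeasure lborel {t \<in> {0..<2 * pi}. a + of_real \<rho> * cis t \<in> A}"
    using A(2) by (intro emeasure_mono) auto
  moreover have "0 < emeasure lborel {t0<..<e}"
    using e by simp
  ultimately show ?thesis
    using A \<rho> by (auto simp: emeasure_circle_arclength ennreal_zero_less_mult_iff)
qed

lemma radius_pos: "x \<in> ball a \<rho> \<Longrightarrow> 0 < \<rho>"
  by (metis mem_ball zero_le_dist order_le_less_trans)

lemma poisson_kernel_pos:
  assumes "x \<in> ball a \<rho>" "y \<in> sphere a \<rho>"
  shows "0 < poisson_kernel a \<rho> x y"
proof -
  have "x \<noteq> y" "norm (x - a) < \<rho>"
    using assms by (auto simp: dist_norm norm_minus_commute)
  then show ?thesis
    by (auto simp: poisson_kernel_def intro!: divide_pos_pos power_strict_mono)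
qed

lemma measurable_poisson_kernel [measurable]:
  "poisson_kernel a \<rho> x \<in> borel_measurable borel"
  unfolding poisson_kernel_def by measurable

text \<open>
  With $w = y - a$ and $z = x - a$ the kernel is the real part of $(w + z) / (w - z)$, and
  $\frac{w + z}{(w - z) w} = \frac{2}{w - z} - \frac{1}{w}$. Cauchy's formula evaluates the two
  contour integrals to $2 \cdot 2 \pi i$ and $2 \pi i$.
\<close>
lemma integral_poisson_kernel:
  assumes x: "x \<in> ball a \<rho>"
  shows "(LINT y|circle_arclength a \<rho>. poisson_kernel a \<rho> x y) = 2 * pi * \<rho>"
proof -
  have \<rho>: "0 < \<rho>"
    using x by (rule radius_pos)
  define y where "y = (\<lambda>t. a + of_real \<rho> * cis t)"
  have nx: "norm (x - a) < \<rho>"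
    using x by (simp add: dist_norm norm_minus_commute)
  have 1: "((\<lambda>u. 1 / (u - x)) has_contour_integral 2 * of_real pi * \<i>) (circlepath a \<rho>)"
    using Cauchy_integral_circlepath_simple[of "\<lambda>_. 1" a \<rho> x] nx by simp
  have 2: "((\<lambda>u. 1 / (u - a)) has_contour_integral 2 * of_real pi * \<i>) (circlepath a \<rho>)"
    using Cauchy_integral_circlepath_simple[of "\<lambda>_. 1" a \<rho> a] \<rho> by simp
  have "((\<lambda>u. 2 * (1 / (u - x)) - 1 / (u - a)) has_contour_integral 2 * (2 * of_real pi * \<i>) - 2 * of_real pi * \<i>)
      (circlepath a \<rho>)"
    by (intro has_contour_integral_diff has_contour_integral_lmul 1 2)
  then have "((\<lambda>t. (2 * (1 / (y t - x)) - 1 / (y t - a)) * of_real \<rho> * \<i> * cis t)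
      has_integral 2 * of_real pi * \<i>) {0..2 * pi}"
    unfolding circlepath_def y_def
    by (subst (asm) has_contour_integral_part_circlepath_iff) (simp_all add: mult.commute mult.left_commute)
  from has_integral_mult_right[OF this, of "- \<i>"]
  have "((\<lambda>t. - \<i> * ((2 * (1 / (y t - x)) - 1 / (y t - a)) * of_real \<rho> * \<i> * cis t))
      has_integral of_real (2 * pi)) {0..2 * pi}"
    by (rule has_integral_eq_rhs) (simp add: complex_eq_iff)
  from has_integral_linear[OF this bounded_linear_Re]
  have "((\<lambda>t. Re (- \<i> * ((2 * (1 / (y t - x)) - 1 / (y t - a)) * of_real \<rho> * \<i> * cis t)))
      has_integral 2 * pi) {0..2 * pi}"
    by (simp add: o_def)
  moreover have "Re (- \<i> * ((2 * (1 / (y t - x)) - 1 / (y t - a)) * of_real \<rho> * \<i> * cis t))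
      = poisson_kernel a \<rho> x (y t)" for t
  proof -
    define w where "w = y t - a"
    define z where "z = x - a"
    have w: "norm w = \<rho>" "of_real \<rho> * cis t = w"
      using \<rho> by (simp_all add: w_def y_def norm_mult)
    then have wz: "w \<noteq> 0" "w \<noteq> z"
      using \<rho> nx by (auto simp: z_def)
    have "- \<i> * (A * R * \<i> * C) = A * (R * C)" for A R C :: complex
      by (simp add: complex_eq_iff algebra_simps)
    then have "- \<i> * ((2 * (1 / (y t - x)) - 1 / (y t - a)) * of_real \<rho> * \<i> * cis t) =
        (2 * (1 / (y t - x)) - 1 / (y t - a)) * (of_real \<rho> * cis t)" .
    also have "\<dots> = (2 * (1 / (w - z)) - 1 / w) * w"
      unfolding w(2) by (simp add: w_def z_def)
    also have "\<dots> = (w + z) / (w - z)"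
      using w wz by (simp add: field_simps)
    finally have *: "Re (- \<i> * ((2 * (1 / (y t - x)) - 1 / (y t - a)) * of_real \<rho> * \<i> * cis t)) =
        Re ((w + z) / (w - z))" by simp
    have "Re ((w + z) / (w - z)) = Re ((w + z) * cnj (w - z)) / (norm (w - z))\<^sup>2"
      by (subst complex_div_cnj) (simp add: Re_divide_of_real)
    also have "Re ((w + z) * cnj (w - z)) = (norm w)\<^sup>2 - (norm z)\<^sup>2"
      unfolding cmod_power2 by (simp add: algebra_simps power2_eq_square)
    finally show ?thesis
      unfolding * poisson_kernel_def w(1) by (simp add: w_def z_def norm_minus_commute)
  qed
  ultimately have hk: "((\<lambda>t. poisson_kernel a \<rho> x (y t)) has_integral 2 * pi) {0..2 * pi}"
    by simp
  have "norm (y t - a) = \<rho>" for t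
    using \<rho> by (simp add: y_def norm_mult)
  then have ne: "x \<noteq> y t" for t
    using nx by force
  have "continuous_on {0..2 * pi} (\<lambda>t. poisson_kernel a \<rho> x (y t))"
  proof -
    have "\<forall>t\<in>{0..2 * pi}. (norm (x - y t))\<^sup>2 \<noteq> 0"
      using ne by simp
    then show ?thesis
      unfolding poisson_kernel_def y_def by (intro continuous_intros)
  qed
  then have "set_integrable lborel {0..2 * pi} (\<lambda>t. poisson_kernel a \<rho> x (y t))"
    by (intro borel_integrable_atLeastAtMost' )
  then have "(LINT t:{0..2 * pi}|lborel. poisson_kernel a \<rho> x (y t)) = 2 * pi"
    using hk by (simp add: set_borel_integral_eq_integral integral_unique)
  moreover have "(LINT t:{0..<2 * pi}|lborel. poisson_kernel a \<rho> x (y t)) =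
      (LINT t:{0..2 * pi}|lborel. poisson_kernel a \<rho> x (y t))"
    unfolding set_lebesgue_integral_def
    by (rule integral_discrete_difference[where X = "{2 * pi}"]) (auto simp: indicator_def y_def)
  ultimately show ?thesis
    using \<rho> by (subst integral_circle_arclength) (auto simp: y_def)
qed

lemma poisson_kernel_le:
  assumes "y \<in> sphere a \<rho>" "x \<in> cball a (\<rho> - \<delta>)" "0 < \<delta>"
  shows "\<bar>poisson_kernel a \<rho> x y\<bar> \<le> \<rho>\<^sup>2 / \<delta>\<^sup>2"
proof -
  have "norm (y - a) \<le> norm (x - y) + norm (x - a)"
    using norm_triangle_sub[of "y - a" "x - a"] by (simp add: norm_minus_commute add.commute)
  then have *: "\<delta> \<le> norm (x - y)" "norm (x - a) \<le> \<rho>"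
    using assms by (auto simp: dist_norm norm_minus_commute)
  have "\<bar>\<rho>\<^sup>2 - (norm (x - a))\<^sup>2\<bar> \<le> \<rho>\<^sup>2"
    using power_mono[OF *(2), of 2] by simp
  then show ?thesis
    unfolding poisson_kernel_def abs_divide using * assms(3)
    by (auto intro!: frac_le power_mono)
qed

lemma integrable_poisson_kernel_mult:
  fixes g :: "complex \<Rightarrow> real"
  assumes x: "x \<in> ball a \<rho>" and g: "integrable (circle_arclength a \<rho>) g"
  shows "integrable (circle_arclength a \<rho>) (\<lambda>y. poisson_kernel a \<rho> x y * g y)"
proof -
  have \<rho>: "0 < \<rho>"
    using x by (rule radius_pos)
  define \<delta> where "\<delta> = \<rho> - dist a x"
  have \<delta>: "0 < \<delta>" "x \<in> cball a (\<rho> - \<delta>)"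
    using x by (auto simp: \<delta>_def)
  have [measurable]: "g \<in> borel_measurable borel"
    using g by (auto dest!: borel_measurable_integrable cong: measurable_cong_sets)
  show ?thesis
  proof (rule Bochner_Integration.integrable_bound)
    show "integrable (circle_arclength a \<rho>) (\<lambda>y. \<rho>\<^sup>2 / \<delta>\<^sup>2 * g y)"
      using g by (intro integrable_mult_right) 
    show "AE y in circle_arclength a \<rho>. norm (poisson_kernel a \<rho> x y * g y) \<le> norm (\<rho>\<^sup>2 / \<delta>\<^sup>2 * g y)"
      using AE_circle_arclength_sphere[OF \<rho>, of a]
    proof eventually_elim
      case (elim y)
      show ?case
        using mult_right_mono[OF poisson_kernel_le[OF elim \<delta>(2,1)], of "\<bar>g y\<bar>"]
        by (simp add: abs_mult)
    qed
  qed measurable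
qed

lemma continuous_on_poisson:
  fixes g :: "complex \<Rightarrow> real"
  assumes g: "integrable (circle_arclength a \<rho>) g"
  shows "continuous_on (ball a \<rho>) (poisson a \<rho> g)"
proof (rule continuous_on_sequentiallyI)
  fix X x assume X: "\<forall>n. X n \<in> ball a \<rho>" and x: "x \<in> ball a \<rho>" and lim: "X \<longlonglongrightarrow> x"
  have \<rho>: "0 < \<rho>"
    using x by (rule radius_pos)
  have [measurable]: "g \<in> borel_measurable borel"
    using g by (auto dest!: borel_measurable_integrable cong: measurable_cong_sets)
  define \<delta> where "\<delta> = (\<rho> - dist a x) / 2"
  have \<delta>: "0 < \<delta>"
    using x by (auto simp: \<delta>_def)
  have "eventually (\<lambda>n. dist (X n) x < \<delta>) sequentially"
    using lim \<delta> by (auto simp: tendsto_iff)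
  then have "eventually (\<lambda>n. X n \<in> cball a (\<rho> - \<delta>)) sequentially"
  proof eventually_elim
    case (elim n)
    have "dist a (X n) \<le> dist a x + dist (X n) x"
      by (metis dist_commute dist_triangle)
    then show ?case
      using elim unfolding mem_cball \<delta>_def by (simp add: field_simps)
  qed
  then obtain n0 where n0: "\<And>n. n \<ge> n0 \<Longrightarrow> X n \<in> cball a (\<rho> - \<delta>)"
    by (auto simp: eventually_sequentially)
  have "(\<lambda>n. LINT y|circle_arclength a \<rho>. poisson_kernel a \<rho> (X (n + n0)) y * g y)
      \<longlonglongrightarrow> (LINT y|circle_arclength a \<rho>. poisson_kernel a \<rho> x y * g y)"
  proof (rule integral_dominated_convergence[where w = "\<lambda>y. norm (\<rho>\<^sup>2 / \<delta>\<^sup>2 * g y)"])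
    show "integrable (circle_arclength a \<rho>) (\<lambda>y. norm (\<rho>\<^sup>2 / \<delta>\<^sup>2 * g y))"
      using g by (intro integrable_norm integrable_mult_right)
    show "AE y in circle_arclength a \<rho>.
        (\<lambda>n. poisson_kernel a \<rho> (X (n + n0)) y * g y) \<longlonglongrightarrow> poisson_kernel a \<rho> x y * g y"
      using AE_circle_arclength_sphere[OF \<rho>, of a]
    proof eventually_elim
      case (elim y)
      have "x \<noteq> y"
        using elim x by auto
      then show ?case
        unfolding poisson_kernel_def using LIMSEQ_ignore_initial_segment[OF lim, of n0]
        by (intro tendsto_intros) auto
    qed
    show "AE y in circle_arclength a \<rho>.
        norm (poisson_kernel a \<rho> (X (n + n0)) y * g y) \<le> norm (\<rho>\<^sup>2 / \<delta>\<^sup>2 * g y)" for n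
      using AE_circle_arclength_sphere[OF \<rho>, of a]
    proof eventually_elim
      case (elim y)
      show ?case
        using mult_right_mono[OF poisson_kernel_le[OF elim n0[of "n + n0"] \<delta>], of "\<bar>g y\<bar>"]
        by (simp add: abs_mult)
    qed
  qed measurable
  then have "(\<lambda>n. poisson a \<rho> g (X (n + n0))) \<longlonglongrightarrow> poisson a \<rho> g x"
    unfolding poisson_def by (intro tendsto_intros)
  then show "(\<lambda>n. poisson a \<rho> g (X n)) \<longlonglongrightarrow> poisson a \<rho> g x"
    by (rule LIMSEQ_offset)
qed

lemma integrable_bounded_circle:
  fixes g :: "complex \<Rightarrow> real"
  assumes "g \<in> borel_measurable borel" "\<And>y. 0 \<le> g y" "\<And>y. g y \<le> 1"
  shows "integrable (circle_arclength a \<rho>) g"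
  using assms
  by (intro finite_measure.integrable_const_bound[OF finite_measure_circle_arclength, of _ 1])
    (auto cong: measurable_cong_sets)

lemma one_minus_poisson:
  assumes x: "x \<in> ball a \<rho>" and g: "g \<in> borel_measurable borel" "\<And>y. 0 \<le> g y" "\<And>y. g y \<le> 1"
  shows "1 - poisson a \<rho> g x = poisson a \<rho> (\<lambda>y. 1 - g y) x"
proof -
  have \<rho>: "0 < \<rho>"
    using x by (rule radius_pos)
  have 1: "integrable (circle_arclength a \<rho>) (\<lambda>y. poisson_kernel a \<rho> x y * 1)"
    by (rule integrable_poisson_kernel_mult[OF x integrable_bounded_circle]) auto
  have 2: "integrable (circle_arclength a \<rho>) (\<lambda>y. poisson_kernel a \<rho> x y * g y)"
    by (rule integrable_poisson_kernel_mult[OF x integrable_bounded_circle[OF g]])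
  show ?thesis
    unfolding poisson_def using 1 2 integral_poisson_kernel[OF x] \<rho>
    by (simp add: right_diff_distrib)
qed

lemma poisson_nonneg:
  assumes x: "x \<in> ball a \<rho>" and g: "\<And>y. 0 \<le> g y"
  shows "0 \<le> poisson a \<rho> g x"
proof -
  have \<rho>: "0 < \<rho>"
    using x by (rule radius_pos)
  have "0 \<le> (LINT y|circle_arclength a \<rho>. poisson_kernel a \<rho> x y * g y)"
    using AE_circle_arclength_sphere[OF \<rho>, of a]
    by (intro integral_nonneg_AE, elim eventually_mono)
      (intro mult_nonneg_nonneg g less_imp_le[OF poisson_kernel_pos[OF x]])
  then show ?thesis
    using \<rho> by (simp add: poisson_def)
qed

lemma poisson_le_1:
  assumes x: "x \<in> ball a \<rho>" and g: "g \<in> borel_measurable borel" "\<And>y. 0 \<le> g y" "\<And>y. g y \<le> 1"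
  shows "poisson a \<rho> g x \<le> 1"
  using one_minus_poisson[OF x g] poisson_nonneg[OF x, of "\<lambda>y. 1 - g y"] g by simp

text \<open>
  The strict maximum principle: the kernel is positive, so if the integral of
  \<open>poisson_kernel * (1 - g)\<close> vanishes, then \<open>g = 1\<close> almost everywhere.
\<close>
lemma poisson_less_1:
  assumes x: "x \<in> ball a \<rho>" and g: "g \<in> borel_measurable borel" "\<And>y. 0 \<le> g y" "\<And>y. g y \<le> 1"
    and A: "A \<in> sets borel" "0 < emeasure (circle_arclength a \<rho>) A"
      "AE y in circle_arclength a \<rho>. y \<in> A \<longrightarrow> g y < 1"
  shows "poisson a \<rho> g x < 1"
proof (rule ccontr)
  have \<rho>: "0 < \<rho>"
    using x by (rule radius_pos)
  assume "\<not> poisson a \<rho> g x < 1"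
  then have "poisson a \<rho> (\<lambda>y. 1 - g y) x = 0"
    using poisson_le_1[OF x g] one_minus_poisson[OF x g] by simp
  then have "(LINT y|circle_arclength a \<rho>. poisson_kernel a \<rho> x y * (1 - g y)) = 0"
    using \<rho> by (simp add: poisson_def)
  moreover have "integrable (circle_arclength a \<rho>) (\<lambda>y. poisson_kernel a \<rho> x y * (1 - g y))"
    by (intro integrable_poisson_kernel_mult[OF x] integrable_bounded_circle) (use g in auto)
  moreover have "AE y in circle_arclength a \<rho>. 0 \<le> poisson_kernel a \<rho> x y * (1 - g y)"
    using AE_circle_arclength_sphere[OF \<rho>, of a]
    by eventually_elim (intro mult_nonneg_nonneg less_imp_le[OF poisson_kernel_pos[OF x]], simp_all add: g)
  ultimately have "AE y in circle_arclength a \<rho>. poisson_kernel a \<rho> x y * (1 - g y) = 0"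
    by (simp add: integral_nonneg_eq_0_iff_AE)
  with AE_circle_arclength_sphere[OF \<rho>, of a] A(3)
  have "AE y in circle_arclength a \<rho>. y \<notin> A"
    by eventually_elim (use poisson_kernel_pos[OF x] in force)
  then have "emeasure (circle_arclength a \<rho>) A = 0"
    using A(1) by (subst (asm) AE_iff_measurable[of A]) auto
  with A(2) show False by simp
qed

text \<open>
  The product of \<open>\<kappa>\<close> and the angle \<open>\<beta> - \<alpha>\<close> bounds, up to the factor \<open>2 * pi\<close>, the
  harmonic measure of the arc from below, and the part \<open>\<delta>\<close> of it is lost by the datum \<open>g\<close>.
\<close>
lemma poisson_le_if_small_on_arc:
  assumes x: "x \<in> ball a \<rho>" and g: "g \<in> borel_measurable borel" "\<And>y. 0 \<le> g y" "\<And>y. g y \<le> 1"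
    and J: "{\<alpha><..<\<beta>} \<subseteq> {0..<2 * pi}" "\<alpha> \<le> \<beta>" and "0 \<le> \<kappa>" "0 \<le> \<delta>"
    and ker: "\<And>t. t \<in> {\<alpha><..<\<beta>} \<Longrightarrow> \<kappa> \<le> poisson_kernel a \<rho> x (a + of_real \<rho> * cis t)"
    and small: "\<And>t. t \<in> {\<alpha><..<\<beta>} \<Longrightarrow> g (a + of_real \<rho> * cis t) \<le> 1 - \<delta>"
  shows "poisson a \<rho> g x \<le> 1 - \<kappa> * \<delta> * (\<beta> - \<alpha>) / (2 * pi)"
proof -
  have \<rho>: "0 < \<rho>"
    using x by (rule radius_pos)
  define h where "h = (\<lambda>t. poisson_kernel a \<rho> x (a + of_real \<rho> * cis t) * (1 - g (a + of_real \<rho> * cis t)))"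
  note [measurable] = g(1)
  have hpos: "0 \<le> h t" for t
    unfolding h_def using \<rho> g
    by (intro mult_nonneg_nonneg less_imp_le[OF poisson_kernel_pos[OF x]]) (auto simp: dist_norm norm_mult)
  have "integrable (circle_arclength a \<rho>) (\<lambda>y. poisson_kernel a \<rho> x y * (1 - g y))"
    by (intro integrable_poisson_kernel_mult[OF x] integrable_bounded_circle) (use g in auto)
  then have "integrable (distr (restrict_space lborel {0..<2 * pi}) borel (\<lambda>t. a + of_real \<rho> * cis t))
      (\<lambda>y. \<rho> * (poisson_kernel a \<rho> x y * (1 - g y)))"
    unfolding circle_arclength_eq_density using \<rho> by (subst (asm) integrable_density) auto
  then have "integrable (distr (restrict_space lborel {0..<2 * pi}) borel (\<lambda>t. a + of_real \<rho> * cis t))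
      (\<lambda>y. poisson_kernel a \<rho> x y * (1 - g y))"
    using \<rho> by simp
  then have int: "integrable lborel (\<lambda>t. indicator {0..<2 * pi} t *\<^sub>R h t)"
    by (subst (asm) integrable_distr_eq)
      (auto simp: integrable_restrict_space h_def measurable_restrict_space1)
  have "\<kappa> * \<delta> * (\<beta> - \<alpha>) = (LINT t|lborel. \<kappa> * \<delta> * indicator {\<alpha><..<\<beta>} t)"
    using J by simp
  also have "\<dots> \<le> (LINT t|lborel. indicator {0..<2 * pi} t *\<^sub>R h t)"
  proof (rule integral_mono[OF _ int])
    show "integrable lborel (\<lambda>t. \<kappa> * \<delta> * indicator {\<alpha><..<\<beta>} t)"
      using J by (intro integrable_mult_right integrable_real_indicator) auto
    show "\<kappa> * \<delta> * indicator {\<alpha><..<\<beta>} t \<le> indicator {0..<2 * pi} t *\<^sub>R h t" for t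
    proof (cases "t \<in> {\<alpha><..<\<beta>}")
      case True
      have "\<kappa> * \<delta> \<le> h t"
        unfolding h_def using ker[OF True] small[OF True] assms(7,8) by (intro mult_mono) auto
      then show ?thesis
        using True J by (simp add: subset_eq)
    qed (use hpos in auto)
  qed
  also have "\<dots> = 2 * pi * poisson a \<rho> (\<lambda>y. 1 - g y) x"
    unfolding poisson_def using \<rho>
    by (subst integral_circle_arclength) (auto simp: h_def set_lebesgue_integral_def)
  also have "\<dots> = 2 * pi * (1 - poisson a \<rho> g x)"
    by (simp only: one_minus_poisson[OF x g])
  finally show ?thesis
    by (simp add: field_simps)
qed

section \<open>Two circles with a common point\<close>

text \<open>
  The numerator of the Poisson kernel is the power of \<open>x\<close> with respect to the circle. Along another
  circle this power is an affine function of \<open>x\<close> (its zero set is the radical axis), so its growth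
  away from a common point \<open>p\<close> can be read off from one inner product.
\<close>
lemma power_of_point_on_circle:
  fixes a b x p :: complex
  assumes "x \<in> sphere b s" "p \<in> sphere b s" "p \<in> sphere a \<rho>"
  shows "\<rho>\<^sup>2 - (norm (x - a))\<^sup>2 = 2 * ((p - x) \<bullet> (b - a))"
proof -
  have "norm (x - b) = s" "norm (p - b) = s" "norm (p - a) = \<rho>"
    using assms by (auto simp: dist_norm norm_minus_commute)
  then have "(x - b) \<bullet> (x - b) = s\<^sup>2" "(p - b) \<bullet> (p - b) = s\<^sup>2" "(p - a) \<bullet> (p - a) = \<rho>\<^sup>2"
    by (auto simp: dot_square_norm)
  then show ?thesis
    unfolding dot_square_norm[symmetric] by (simp add: inner_complex_def algebra_simps)
qed

text \<open>
  For \<open>x\<close> on both circles the real part of \<open>(x - a) * cnj (b - a)\<close> is determined by the distances,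
  and then so is its imaginary part up to sign.
\<close>
lemma finite_Int_spheres:
  fixes a b :: complex
  assumes "a \<noteq> b"
  shows "finite (sphere a \<rho> \<inter> sphere b s)"
proof -
  define w where "w = b - a"
  define A where "A = (\<rho>\<^sup>2 + (norm w)\<^sup>2 - s\<^sup>2) / 2"
  define B where "B = sqrt (\<rho>\<^sup>2 * (norm w)\<^sup>2 - A\<^sup>2)"
  have w: "cnj w \<noteq> 0"
    using assms by (simp add: w_def)
  have "x \<in> {a + Complex A B / cnj w, a + Complex A (- B) / cnj w}"
    if x: "x \<in> sphere a \<rho> \<inter> sphere b s" for x
  proof -
    define z where "z = (x - a) * cnj w"
    have n: "norm (x - a) = \<rho>" "norm (x - a - w) = s"
      using x by (auto simp: dist_norm norm_minus_commute w_def)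
    have "s\<^sup>2 = \<rho>\<^sup>2 + (norm w)\<^sup>2 - 2 * ((x - a) \<bullet> w)"
      unfolding n[symmetric] dot_square_norm[symmetric]
      by (simp add: inner_diff_left inner_diff_right inner_commute)
    then have Re: "Re z = A"
      by (simp add: A_def z_def inner_complex_def field_simps)
    have "(norm z)\<^sup>2 = \<rho>\<^sup>2 * (norm w)\<^sup>2"
      using n by (simp add: z_def norm_mult power_mult_distrib)
    then have "(Im z)\<^sup>2 = \<rho>\<^sup>2 * (norm w)\<^sup>2 - A\<^sup>2"
      by (simp add: cmod_power2[of z] Re)
    moreover from this have "B\<^sup>2 = \<rho>\<^sup>2 * (norm w)\<^sup>2 - A\<^sup>2"
      unfolding B_def by (metis real_sqrt_pow2 zero_le_power2)
    ultimately have "Im z = B \<or> Im z = - B"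
      by (metis power2_eq_iff)
    then have "z = Complex A B \<or> z = Complex A (- B)"
      using Re by (auto simp: complex_eq_iff)
    moreover have "x = a + z / cnj w"
      using w by (simp add: z_def)
    ultimately show ?thesis
      by auto
  qed
  then have "sphere a \<rho> \<inter> sphere b s \<subseteq> {a + Complex A B / cnj w, a + Complex A (- B) / cnj w}"
    by blast
  then show ?thesis
    by (rule finite_subset) simp
qed

text \<open>
  Two linearly independent vectors \<open>n\<close> and \<open>w\<close> recover \<open>e\<close> from the inner products:
  \<open>\<i> * e\<close> times the cross product of \<open>n\<close> and \<open>w\<close> equals \<open>(e \<bullet> n) * w - (e \<bullet> w) * n\<close>.
\<close>
lemma cross_product_bound:
  "\<bar>Im (cnj n * w)\<bar> * norm e \<le> \<bar>e \<bullet> n\<bar> * norm w + \<bar>e \<bullet> w\<bar> * norm n"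
proof -
  have "of_real (Im (cnj n * w)) * (\<i> * e) = of_real (e \<bullet> n) * w - of_real (e \<bullet> w) * n"
    by (simp add: complex_eq_iff inner_complex_def algebra_simps)
  then have "norm (of_real (Im (cnj n * w)) * (\<i> * e)) = norm (of_real (e \<bullet> n) * w - of_real (e \<bullet> w) * n)"
    by (rule arg_cong)
  also have "\<dots> \<le> norm (of_real (e \<bullet> n) * w) + norm (of_real (e \<bullet> w) * n)"
    by (rule norm_triangle_ineq4)
  finally show ?thesis
    unfolding norm_mult norm_of_real norm_ii by simp
qed

section \<open>Approaching a point of a circle from one side\<close>

text \<open>
  The direction \<open>s\<close> is meant to be 1 or -1, so that both sides of the point at angle \<open>t\<close> are
  treated by the same lemmas, with the parameter \<open>\<tau>\<close> tending to 0 from the right. At \<open>\<tau> = 0\<close> the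
  direction has no influence.
\<close>
definition circle_walk :: "complex \<Rightarrow> real \<Rightarrow> real \<Rightarrow> real \<Rightarrow> real \<Rightarrow> complex" where
  "circle_walk a \<rho> t s \<tau> = a + of_real \<rho> * cis (t + s * \<tau>)"

lemma dist_circle_walk [simp]: "0 < \<rho> \<Longrightarrow> dist a (circle_walk a \<rho> t s \<tau>) = \<rho>"
  by (simp add: circle_walk_def dist_norm norm_mult)

lemma tendsto_circle_walk: "(circle_walk a \<rho> t s \<longlongrightarrow> circle_walk a \<rho> t s 0) (at_right 0)"
proof -
  have "continuous_on UNIV (circle_walk a \<rho> t s)"
    unfolding circle_walk_def by (intro continuous_intros)
  then show ?thesis
    by (auto simp: continuous_on_def intro: tendsto_within_subset)
qed

lemma eventually_circle_walk_ne:
  assumes "0 < \<rho>" "s \<in> {1, -1}"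
  shows "\<forall>\<^sub>F \<tau> in at_right 0. circle_walk a \<rho> t s \<tau> \<noteq> circle_walk a \<rho> t s 0"
proof -
  have "\<forall>\<^sub>F \<tau> in at_right 0. 0 < \<tau> \<and> \<tau> < pi"
    by (auto simp: eventually_at_right[of 0 pi] intro!: exI[of _ pi])
  then show ?thesis
  proof eventually_elim
    case (elim \<tau>)
    show ?case
    proof
      assume "circle_walk a \<rho> t s \<tau> = circle_walk a \<rho> t s 0"
      then have "cis t * cis (s * \<tau>) = cis t * 1"
        using assms by (simp add: circle_walk_def cis_mult)
      then have "cis (s * \<tau>) = 1"
        by (simp only: mult_left_cancel cis_neq_zero simp_thms)
      then have "sin (s * \<tau>) = 0"
        by (metis cis.sel(2) one_complex.sel(2))
      then have "sin \<tau> = 0"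
        using assms(2) by auto
      then show False
        using elim sin_gt_zero[of \<tau>] by auto
    qed
  qed
qed

lemma eventually_circle_walk_notin_finite:
  assumes "0 < \<rho>" "s \<in> {1, -1}" "finite F"
  shows "\<forall>\<^sub>F \<tau> in at_right 0. circle_walk a \<rho> t s \<tau> \<notin> F"
proof -
  let ?p = "circle_walk a \<rho> t s 0"
  have "open (- (F - {?p}))"
    using assms(3) by (intro open_Compl finite_imp_closed) auto
  then have "\<forall>\<^sub>F \<tau> in at_right 0. circle_walk a \<rho> t s \<tau> \<in> - (F - {?p})"
    by (rule topological_tendstoD[OF tendsto_circle_walk]) auto
  with eventually_circle_walk_ne[OF assms(1,2)] show ?thesis
    by eventually_elim auto
qed

lemma norm_circle_walk_diff_le:
  assumes "0 < \<rho>" "s \<in> {1, -1}" "0 \<le> \<tau>"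
  shows "norm (circle_walk a \<rho> t s \<tau> - circle_walk a \<rho> t s 0) \<le> \<rho> * \<tau>"
proof -
  have "circle_walk a \<rho> t s \<tau> - circle_walk a \<rho> t s 0 = of_real \<rho> * cis t * (cis (s * \<tau>) - 1)"
    by (simp add: circle_walk_def cis_mult[symmetric] algebra_simps)
  then have "norm (circle_walk a \<rho> t s \<tau> - circle_walk a \<rho> t s 0) = \<rho> * norm (cis (s * \<tau>) - 1)"
    using assms(1) by (simp add: norm_mult)
  also have "norm (cis (s * \<tau>) - 1) = 2 * \<bar>sin (s * \<tau> / 2)\<bar>"
    unfolding cis_conv_exp by (rule dist_exp_i_1)
  also have "\<dots> \<le> 2 * \<bar>s * \<tau> / 2\<bar>"
    by (intro mult_left_mono abs_sin_x_le_abs_x) simp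
  also have "\<dots> = \<tau>"
    using assms(2,3) by auto
  finally show ?thesis
    using assms(1) by simp
qed

text \<open>The argument of \<open>(y - a) / (p - a)\<close> is continuous at \<open>p\<close>, and gives both \<open>s\<close> and \<open>\<tau>\<close>.\<close>
lemma circle_near_point:
  assumes "0 < \<rho>" "0 < e"
  obtains V where "open V" "circle_walk a \<rho> t s0 0 \<in> V"
    "\<And>y. y \<in> V \<Longrightarrow> y \<in> sphere a \<rho> \<Longrightarrow> y \<noteq> circle_walk a \<rho> t s0 0 \<Longrightarrow>
      \<exists>s\<in>{1, -1}. \<exists>\<tau>. 0 < \<tau> \<and> \<tau> < e \<and> y = circle_walk a \<rho> t s \<tau>"
proof -
  let ?p = "circle_walk a \<rho> t s0 0"
  define z where "z = (\<lambda>y. (y - a) / (of_real \<rho> * cis t))"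
  have zp: "z ?p = 1"
    using assms by (simp add: z_def circle_walk_def)
  have "isCont (\<lambda>y. Arg (z y)) ?p"
  proof (rule isCont_o2[where f = z and g = Arg])
    show "isCont z ?p"
      unfolding z_def using assms by (intro continuous_intros) auto
    show "isCont Arg (z ?p)"
      unfolding zp by (rule continuous_at_Arg) auto
  qed
  then have "((\<lambda>y. Arg (z y)) \<longlongrightarrow> 0) (nhds ?p)"
    using tendsto_at_iff_tendsto_nhds[of "\<lambda>y. Arg (z y)" ?p] zp by (simp add: isCont_def)
  then have "\<forall>\<^sub>F y in nhds ?p. dist (Arg (z y)) 0 < e"
    using assms by (simp add: tendsto_iff)
  then obtain V where V: "open V" "?p \<in> V" "\<And>y. y \<in> V \<Longrightarrow> \<bar>Arg (z y)\<bar> < e"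
    by (auto simp: eventually_nhds)
  show ?thesis
  proof (rule that[OF V(1,2)])
    fix y assume y: "y \<in> V" "y \<in> sphere a \<rho>" "y \<noteq> ?p"
    define \<theta> where "\<theta> = Arg (z y)"
    have "norm (z y) = 1"
      using y assms by (simp add: z_def norm_divide norm_mult dist_norm norm_minus_commute)
    then have "z y = cis \<theta>"
      by (metis \<theta>_def cis_Arg norm_zero sgn_div_norm zero_neq_one div_by_1 inverse_1 scaleR_one)
    then have ye: "y = a + of_real \<rho> * cis (t + \<theta>)"
      using assms by (simp add: z_def field_simps cis_mult[symmetric])
    have "\<theta> \<noteq> 0"
      using ye y(3) by (auto simp: circle_walk_def)
    moreover have "\<bar>\<theta>\<bar> < e"
      using V(3)[OF y(1)] by (simp add: \<theta>_def)
    moreover have "y = circle_walk a \<rho> t (sgn \<theta>) \<bar>\<theta>\<bar>"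
      unfolding circle_walk_def using ye by (simp add: sgn_mult_abs)
    ultimately show "\<exists>s\<in>{1, -1}. \<exists>\<tau>. 0 < \<tau> \<and> \<tau> < e \<and> y = circle_walk a \<rho> t s \<tau>"
      by (intro bexI[of _ "sgn \<theta>"] exI[of _ "\<bar>\<theta>\<bar>"]) (auto simp: sgn_if)
  qed
qed

section \<open>Circles of a family of disks\<close>

context disk_family
begin

lemma open_disk [simp]: "open (disk i)"
  by (simp add: disk_def)

lemma open_\<Omega>: "open \<Omega>"
  unfolding \<Omega>_def by (intro open_UN ballI open_disk)

lemma rel_int_iff:
  "x \<in> rel_int i A \<longleftrightarrow>
     x \<in> frontier (disk i) \<and> (\<exists>V. open V \<and> x \<in> V \<and> V \<inter> frontier (disk i) \<subseteq> A)"
  unfolding rel_int_def interior_of_def openin_open by blast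

lemma nbrs_subset: "nbrs i \<subseteq> {1..N}"
  and finite_nbrs [simp]: "finite (nbrs i)"
  and nbrs_irrefl: "j \<in> nbrs i \<Longrightarrow> j \<noteq> i"
  by (auto simp: nbrs_def)

lemma nbrs_sym: "j \<in> nbrs i \<Longrightarrow> i \<in> {1..N} \<Longrightarrow> i \<in> nbrs j"
  by (auto simp: nbrs_def)

lemma Gam_subset: "Gam i j k \<subseteq> frontier (disk i) \<inter> disk j"
  unfolding Gam_def rel_int_def
  using interior_of_subset[of "top_of_set (frontier (disk i))"] by (auto split: if_splits)

lemma Skel2_subset: "Skel2 j i \<subseteq> frontier (disk i) \<inter> closure (disk j)"
proof -
  have "(\<Union>k\<in>nbrs2 j i. Gam i j k) \<subseteq> frontier (disk i) \<inter> closure (disk j)"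
    using Gam_subset closure_subset by blast
  then show ?thesis
    unfolding Skel2_def by (intro closure_minimal closed_Int) auto
qed

lemma closed_Skel: "closed (Skel i)"
  unfolding Skel_def Skel2_def by (intro closed_UN) auto

definition crossings :: "complex set" where
  "crossings = (\<Union>i\<in>{1..N}. \<Union>k\<in>{1..N} - {i}. frontier (disk i) \<inter> frontier (disk k))"

lemma off_crossings:
  assumes "i \<in> {1..N}" "k \<in> {1..N}" "k \<noteq> i" "y \<in> frontier (disk i)" "y \<notin> crossings"
  shows "y \<in> disk k \<or> y \<notin> closure (disk k)"
  using assms unfolding crossings_def frontier_def interior_open[OF open_disk] by blast

lemma Gam_ext_not_in_disk:
  assumes "y \<in> disk k" "k \<in> {1..N}"
  shows "y \<notin> Gam_ext i"
proof -
  have "y \<in> \<Omega>"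
    using assms unfolding \<Omega>_def by blast
  then show ?thesis
    unfolding Gam_ext_def frontier_def interior_open[OF open_\<Omega>] by blast
qed

lemma in_Gam_ext:
  assumes "i \<in> {1..N}" "y \<in> frontier (disk i)" "\<And>k. k \<in> {1..N} \<Longrightarrow> y \<notin> disk k"
  shows "y \<in> Gam_ext i"
proof -
  have "disk i \<subseteq> \<Omega>"
    using assms(1) unfolding \<Omega>_def by blast
  then have "y \<in> closure \<Omega>"
    using assms(2) closure_mono[of "disk i" \<Omega>] unfolding frontier_def by blast
  moreover have "y \<notin> \<Omega>"
    using assms(3) unfolding \<Omega>_def by blast
  ultimately show ?thesis
    using assms(2) unfolding Gam_ext_def frontier_def[of \<Omega>] interior_open[OF open_\<Omega>] by blast
qed

lemma in_disk_imp_rel_int_Gam_int: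
  assumes "y \<in> frontier (disk i)" "y \<in> disk k" "k \<in> {1..N}"
  shows "y \<in> rel_int i (Gam_int i)"
  unfolding rel_int_iff
proof (intro conjI exI[of _ "disk k"])
  show "disk k \<inter> frontier (disk i) \<subseteq> Gam_int i"
    unfolding Gam_int_def using Gam_ext_not_in_disk assms(3)
    by (intro order_trans[OF _ closure_subset]) blast
qed (use assms in auto)

end

context disk_domain
begin

lemma
  assumes "i \<in> {1..N}"
  shows frontier_disk: "frontier (disk i) = sphere (c i) (r i)"
    and closure_disk: "closure (disk i) = cball (c i) (r i)"
  using r_pos[OF assms] by (simp_all add: disk_def)

text \<open>
  By (A1) each of two neighbouring circles has a point inside the disk of the other. Distances to
  these two points exclude that one disk contains the other and that they touch.
\<close>
lemma neighbours_cross: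
  assumes i: "i \<in> {1..N}" and k: "k \<in> nbrs i"
  shows "\<bar>r i - r k\<bar> < norm (c k - c i)" "norm (c k - c i) < r i + r k"
proof -
  have ik: "k \<in> {1..N}" "i \<noteq> k" "disk i \<inter> disk k \<noteq> {}"
    using k by (auto simp: nbrs_def)
  from A1[OF i ik] obtain Gi Gk where G: "Gi \<subseteq> frontier (disk i) \<inter> disk k" "0 < emeasure (arclength i) Gi"
      "Gk \<subseteq> frontier (disk k) \<inter> disk i" "0 < emeasure (arclength k) Gk"
    by blast
  then have "Gi \<noteq> {}" "Gk \<noteq> {}"
    by auto
  then obtain x y where xy: "x \<in> frontier (disk i)" "x \<in> disk k" "y \<in> frontier (disk k)" "y \<in> disk i"
    using G by blast
  then have "dist (c i) x = r i" "dist (c k) x < r k" "dist (c k) y = r k" "dist (c i) y < r i"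
    using frontier_disk[OF i] frontier_disk[OF ik(1)] by (auto simp: disk_def)
  moreover have "dist (c i) x \<le> dist (c k) (c i) + dist (c k) x" "dist (c k) y \<le> dist (c k) (c i) + dist (c i) y"
    "dist (c k) (c i) \<le> dist (c i) x + dist (c k) x"
    using dist_triangle[of "c i" x "c k"] dist_triangle[of "c k" y "c i"] dist_triangle[of "c k" "c i" x]
    by (simp_all add: dist_commute)
  ultimately show "\<bar>r i - r k\<bar> < norm (c k - c i)" "norm (c k - c i) < r i + r k"
    unfolding dist_norm by linarith+
qed

lemma centres_distinct:
  assumes "i \<in> {1..N}" "k \<in> {1..N}" "i \<noteq> k"
  shows "c i \<noteq> c k"
proof
  assume eq: "c i = c k"
  then have "c i \<in> disk k \<inter> disk i"
    using r_pos assms by (auto simp: disk_def)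
  then have "k \<in> nbrs i"
    using assms by (auto simp: nbrs_def)
  from neighbours_cross(1)[OF assms(1) this] eq show False
    by simp
qed

lemma finite_crossings: "finite crossings"
proof -
  have "finite (frontier (disk i) \<inter> frontier (disk k))" if "i \<in> {1..N}" "k \<in> {1..N} - {i}" for i k
    using centres_distinct[of i k] that frontier_disk[of i] frontier_disk[of k]
    by (metis Diff_iff finite_Int_spheres insertI1)
  then show ?thesis
    unfolding crossings_def by blast
qed

text \<open>
  If the two radii at a common point were parallel, the distance of the centres would be the sum or
  the difference of the radii.
\<close>
lemma neighbours_transversal:
  assumes i: "i \<in> {1..N}" and k: "k \<in> nbrs i"
    and p: "p \<in> frontier (disk i)" "p \<in> frontier (disk k)"
  shows "Im (cnj (p - c i) * (c k - c i)) \<noteq> 0"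
proof
  assume 0: "Im (cnj (p - c i) * (c k - c i)) = 0"
  define u where "u = p - c i"
  define w where "w = c k - c i"
  define D where "D = norm w"
  have ik: "k \<in> {1..N}"
    by (rule subsetD[OF nbrs_subset k])
  have n: "norm u = r i" "norm (u - w) = r k"
    using p frontier_disk[OF i] frontier_disk[OF ik] by (auto simp: u_def w_def dist_norm norm_minus_commute)
  have pos: "0 < r i" "0 < r k"
    using r_pos i ik by auto
  have "(u \<bullet> w)\<^sup>2 + (Im (cnj u * w))\<^sup>2 = (norm u)\<^sup>2 * (norm w)\<^sup>2"
    unfolding cmod_power2 by (simp add: inner_complex_def) (simp add: algebra_simps power2_eq_square)
  then have "(u \<bullet> w)\<^sup>2 = (r i * D)\<^sup>2"
    using 0[folded u_def w_def] n(1) by (simp only: D_def power_mult_distrib) simp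
  then have "u \<bullet> w = r i * D \<or> u \<bullet> w = - (r i * D)"
    by (simp add: power2_eq_iff)
  moreover have "(r k)\<^sup>2 = (r i)\<^sup>2 - 2 * (u \<bullet> w) + D\<^sup>2"
    unfolding n[symmetric] D_def dot_square_norm[symmetric]
    by (simp add: inner_diff_left inner_diff_right inner_commute)
  ultimately have "(r k)\<^sup>2 = (r i - D)\<^sup>2 \<or> (r k)\<^sup>2 = (r i + D)\<^sup>2"
    by (auto simp: power2_eq_square algebra_simps)
  then have "r k = r i - D \<or> r k = - (r i - D) \<or> r k = r i + D \<or> r k = - (r i + D)"
    by (auto simp: power2_eq_iff)
  moreover have "\<bar>r i - r k\<bar> < D" "D < r i + r k"
    using neighbours_cross[OF i k] by (auto simp: D_def w_def)
  ultimately show False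
    using pos by linarith
qed

text \<open>
  Along circle \<open>i\<close> the power with respect to circle \<open>k\<close> vanishes at the crossing and has
  derivative \<open>2 * s * \<beta>\<close> there, where \<open>\<beta>\<close> is the cross product of the radius and the vector between
  the centres.
\<close>
lemma side_dichotomy_at_crossing:
  fixes t :: real
  assumes i: "i \<in> {1..N}" and k: "k \<in> nbrs i"
    and p: "circle_walk (c i) (r i) t s 0 \<in> frontier (disk k)" and s: "s \<in> {1, -1}"
  defines "\<beta> \<equiv> Im (cnj (circle_walk (c i) (r i) t s 0 - c i) * (c k - c i))"
  shows "0 < s * \<beta> \<Longrightarrow> \<forall>\<^sub>F \<tau> in at_right 0. circle_walk (c i) (r i) t s \<tau> \<in> disk k"
    and "s * \<beta> < 0 \<Longrightarrow> \<forall>\<^sub>F \<tau> in at_right 0. circle_walk (c i) (r i) t s \<tau> \<notin> closure (disk k)"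
proof -
  have ik: "k \<in> {1..N}"
    by (rule subsetD[OF nbrs_subset k])
  define w where "w = c k - c i"
  define \<phi> where "\<phi> = (\<lambda>\<tau>. r i * (cos (t + s * \<tau>) - cos t) * Re w + r i * (sin (t + s * \<tau>) - sin t) * Im w)"
  let ?p = "circle_walk (c i) (r i) t s 0"
  have D: "(\<phi> has_real_derivative s * \<beta>) (at 0)"
    unfolding \<phi>_def by (rule derivative_eq_intros refl | simp)+ (simp add: \<beta>_def w_def circle_walk_def algebra_simps)
  have pow: "(r k)\<^sup>2 - (norm (circle_walk (c i) (r i) t s \<tau> - c k))\<^sup>2 = 2 * \<phi> \<tau>" for \<tau>
  proof -
    have "(r k)\<^sup>2 - (norm (circle_walk (c i) (r i) t s \<tau> - c k))\<^sup>2 =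
        2 * ((?p - circle_walk (c i) (r i) t s \<tau>) \<bullet> (c i - c k))"
      using p r_pos[OF i] unfolding frontier_disk[OF ik]
      by (intro power_of_point_on_circle[where s = "r i"]) (simp_all only: mem_sphere dist_circle_walk)
    also have "\<dots> = 2 * \<phi> \<tau>"
      by (simp add: \<phi>_def w_def circle_walk_def inner_complex_def) (simp add: algebra_simps)
    finally show ?thesis .
  qed
  have rk: "0 < r k"
    using r_pos[OF ik] .
  show "\<forall>\<^sub>F \<tau> in at_right 0. circle_walk (c i) (r i) t s \<tau> \<in> disk k" if pos: "0 < s * \<beta>"
  proof -
    obtain d where d: "d > 0" "\<And>h. 0 < h \<Longrightarrow> h < d \<Longrightarrow> \<phi> 0 < \<phi> (0 + h)"
      using DERIV_pos_inc_right[OF D pos] by blast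
    have "circle_walk (c i) (r i) t s h \<in> disk k" if "0 < h" "h < d" for h
    proof -
      have "0 < \<phi> h"
        using d(2)[OF that] by (simp add: \<phi>_def)
      then have "(norm (circle_walk (c i) (r i) t s h - c k))\<^sup>2 < (r k)\<^sup>2"
        using pow[of h] by simp
      then show ?thesis
        using rk by (auto simp: disk_def dist_norm norm_minus_commute intro: power_less_imp_less_base)
    qed
    then show ?thesis
      using d(1) by (auto simp: eventually_at_right[of 0 d])
  qed
  show "\<forall>\<^sub>F \<tau> in at_right 0. circle_walk (c i) (r i) t s \<tau> \<notin> closure (disk k)" if neg: "s * \<beta> < 0"
  proof -
    obtain d where d: "d > 0" "\<And>h. 0 < h \<Longrightarrow> h < d \<Longrightarrow> \<phi> (0 + h) < \<phi> 0"
      using DERIV_neg_dec_right[OF D neg] by blast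
    have "circle_walk (c i) (r i) t s h \<notin> closure (disk k)" if "0 < h" "h < d" for h
    proof -
      have "\<phi> h < 0"
        using d(2)[OF that] by (simp add: \<phi>_def)
      then have "(r k)\<^sup>2 < (norm (circle_walk (c i) (r i) t s h - c k))\<^sup>2"
        using pow[of h] by simp
      then have "r k < norm (circle_walk (c i) (r i) t s h - c k)"
        by (rule power_less_imp_less_base) simp
      then show ?thesis
        using closure_disk[OF ik] by (auto simp: dist_norm norm_minus_commute)
    qed
    then show ?thesis
      using d(1) by (auto simp: eventually_at_right[of 0 d])
  qed
qed

lemma side_off_crossing:
  assumes "circle_walk (c i) (r i) t s 0 \<notin> frontier (disk k)"
  shows "circle_walk (c i) (r i) t s 0 \<in> disk k \<Longrightarrow> \<forall>\<^sub>F \<tau> in at_right 0. circle_walk (c i) (r i) t s \<tau> \<in> disk k"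
    and "circle_walk (c i) (r i) t s 0 \<notin> disk k \<Longrightarrow> \<forall>\<^sub>F \<tau> in at_right 0. circle_walk (c i) (r i) t s \<tau> \<notin> closure (disk k)"
proof -
  show "\<forall>\<^sub>F \<tau> in at_right 0. circle_walk (c i) (r i) t s \<tau> \<in> disk k" if "circle_walk (c i) (r i) t s 0 \<in> disk k"
    by (rule topological_tendstoD[OF tendsto_circle_walk open_disk that])
  assume "circle_walk (c i) (r i) t s 0 \<notin> disk k"
  then have *: "circle_walk (c i) (r i) t s 0 \<in> - closure (disk k)"
    using assms by (auto simp: frontier_def interior_open)
  show "\<forall>\<^sub>F \<tau> in at_right 0. circle_walk (c i) (r i) t s \<tau> \<notin> closure (disk k)"
    using topological_tendstoD[OF tendsto_circle_walk _ *] by auto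
qed

lemma side_dichotomy:
  assumes i: "i \<in> {1..N}" and k: "k \<in> nbrs i" and s: "s \<in> {1, -1}"
  shows "(\<forall>\<^sub>F \<tau> in at_right 0. circle_walk (c i) (r i) t s \<tau> \<in> disk k) \<or>
         (\<forall>\<^sub>F \<tau> in at_right 0. circle_walk (c i) (r i) t s \<tau> \<notin> closure (disk k))"
proof (cases "circle_walk (c i) (r i) t s 0 \<in> frontier (disk k)")
  case True
  have "circle_walk (c i) (r i) t s 0 \<in> frontier (disk i)"
    using r_pos[OF i] frontier_disk[OF i] by simp
  from neighbours_transversal[OF i k this True]
  have "s * Im (cnj (circle_walk (c i) (r i) t s 0 - c i) * (c k - c i)) \<noteq> 0"
    using s by auto
  then show ?thesis
    using side_dichotomy_at_crossing[OF i k True s] by (meson linorder_neqE_linordered_idom)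
qed (use side_off_crossing in blast)

lemma some_side_outside:
  assumes i: "i \<in> {1..N}" and k: "k \<in> nbrs i" and p: "circle_walk (c i) (r i) t s0 0 \<notin> disk k"
  shows "\<exists>s\<in>{1, -1}. \<forall>\<^sub>F \<tau> in at_right 0. circle_walk (c i) (r i) t s \<tau> \<notin> closure (disk k)"
proof (cases "circle_walk (c i) (r i) t s0 0 \<in> frontier (disk k)")
  case True
  have eq: "circle_walk (c i) (r i) t s 0 = circle_walk (c i) (r i) t s0 0" for s
    by (simp add: circle_walk_def)
  have "circle_walk (c i) (r i) t s0 0 \<in> frontier (disk i)"
    using r_pos[OF i] frontier_disk[OF i] by simp
  from neighbours_transversal[OF i k this True]
  obtain s :: real where s: "s \<in> {1, -1}" "s * Im (cnj (circle_walk (c i) (r i) t s0 0 - c i) * (c k - c i)) < 0"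
    by (metis insertI1 insertI2 linorder_neqE_linordered_idom mult_1 mult_minus1 neg_less_0_iff_less)
  then show ?thesis
    using side_dichotomy_at_crossing(2)[OF i k _ s(1), of t] True eq by metis
next
  case False
  then have "circle_walk (c i) (r i) t 1 0 \<notin> frontier (disk k)" "circle_walk (c i) (r i) t 1 0 \<notin> disk k"
    using p by (simp_all add: circle_walk_def)
  from side_off_crossing(2)[OF this] show ?thesis
    by blast
qed

lemma circle_walk_through:
  assumes "i \<in> {1..N}" "p \<in> frontier (disk i)"
  obtains t where "\<And>s. circle_walk (c i) (r i) t s 0 = p"
proof -
  have "norm (p - c i) = r i"
    using assms frontier_disk[OF assms(1)] by (simp add: dist_norm norm_minus_commute)
  then obtain t where "p = c i + of_real (r i) * cis t"
    by (rule circle_param_right)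
  then show ?thesis
    by (intro that[of t]) (simp add: circle_walk_def)
qed

text \<open>
  A point of the outer boundary that lies on no other circle has positive distance from all other
  disks, so a whole arc around it belongs to the outer boundary.
\<close>
lemma not_isolated_off_crossings:
  assumes i: "i \<in> {1..N}" and y: "y \<in> frontier (disk i)" "y \<notin> crossings"
  shows "\<not> y isolated_in Gam_ext i"
proof
  assume "y isolated_in Gam_ext i"
  then obtain T where T: "y \<in> Gam_ext i" "open T" "T \<inter> Gam_ext i = {y}"
    by (auto simp: isolated_in_def)
  define V where "V = (\<Inter>k\<in>{1..N} - {i}. - closure (disk k))"
  have "open V"
    unfolding V_def by (intro open_INT) auto
  have "y \<in> V"
    using off_crossings[OF i _ _ y] Gam_ext_not_in_disk T(1) by (fastforce simp: V_def)
  have sub: "V \<inter> frontier (disk i) \<subseteq> Gam_ext i"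
  proof
    fix z assume z: "z \<in> V \<inter> frontier (disk i)"
    have "z \<notin> disk k" if "k \<in> {1..N}" for k
    proof (cases "k = i")
      case True
      then show ?thesis
        using z unfolding frontier_def interior_open[OF open_disk] by blast
    next
      case False
      then have "z \<notin> closure (disk k)"
        using z that by (auto simp: V_def)
      then show ?thesis
        using closure_subset[of "disk k"] by blast
    qed
    then show "z \<in> Gam_ext i"
      using z by (intro in_Gam_ext[OF i]) auto
  qed
  obtain t where t: "\<And>s. circle_walk (c i) (r i) t s 0 = y"
    by (rule circle_walk_through[OF i y(1)]) blast
  have "\<forall>\<^sub>F \<tau> in at_right 0. circle_walk (c i) (r i) t 1 \<tau> \<in> T \<inter> V"
    using \<open>open V\<close> \<open>y \<in> V\<close> T by (intro topological_tendstoD[OF tendsto_circle_walk]) (auto simp: t)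
  moreover have "\<forall>\<^sub>F \<tau> in at_right 0. circle_walk (c i) (r i) t 1 \<tau> \<noteq> y"
    using eventually_circle_walk_ne[OF r_pos[OF i], of 1 "c i" t] unfolding t by blast
  ultimately have "\<forall>\<^sub>F \<tau> in at_right (0 :: real). False"
  proof eventually_elim
    case (elim \<tau>)
    have "circle_walk (c i) (r i) t 1 \<tau> \<in> frontier (disk i)"
      using r_pos[OF i] frontier_disk[OF i] by simp
    then show False
      using elim sub T(3) by blast
  qed
  then show False
    by simp
qed

end

context disk_partition_of_unity
begin

section \<open>The partition of unity near a point of a circle\<close>

lemma chi_nonneg:
  assumes i: "i \<in> {1..N}" and k: "k \<in> nbrs i" and y: "y \<in> frontier (disk i)" "y \<in> disk j" "j \<in> {1..N}"
  shows "0 \<le> chi i k y"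
proof (cases "y \<in> (\<Union>l\<in>nbrs2 i k. closure (Gam i k l) - Gam_ext i)")
  case True
  then obtain l where "l \<in> nbrs2 i k" "y \<in> closure (Gam i k l) - Gam_ext i"
    by blast
  then show ?thesis
    using chi_one[OF i k, of y] chi_range[OF i k, of l y] by (cases "l = 0") auto
next
  case False
  have "y \<notin> Gam_ext i"
    using Gam_ext_not_in_disk y by blast
  then have "\<not> y isolated_in Gam_ext i"
    by (auto simp: isolated_in_def)
  then show ?thesis
    using chi_zero[OF i k y(1)] False by simp
qed

lemma chi_outside:
  assumes i: "i \<in> {1..N}" and k: "k \<in> nbrs i"
    and y: "y \<in> frontier (disk i)" "y \<notin> crossings" "y \<notin> closure (disk k)"
  shows "chi i k y = 0"
proof (rule chi_zero[OF i k y(1) not_isolated_off_crossings[OF i y(1,2)]])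
  show "y \<notin> (\<Union>l\<in>nbrs2 i k. closure (Gam i k l) - Gam_ext i)"
    using closure_mono[OF order_trans[OF Gam_subset Int_lower2]] y(3) by blast
qed

lemma openin_rel_int: "openin (top_of_set (frontier (disk i))) (rel_int i A)"
  by (simp add: rel_int_def)

text \<open>
  On some side of \<open>p\<close> the circle runs outside of the closed disk \<open>k\<close>, and \<open>chi i k\<close> vanishes there;
  continuity at \<open>p\<close> carries this over to \<open>p\<close>.
\<close>
lemma chi_zero_at_interior_point:
  assumes i: "i \<in> {1..N}" and k: "k \<in> nbrs i"
    and p: "p \<in> rel_int i (Gam_int i)" "p \<notin> disk k"
  shows "chi i k p = 0"
proof -
  have pf: "p \<in> frontier (disk i)"
    using p rel_int_iff by blast
  obtain t where t: "\<And>s. circle_walk (c i) (r i) t s 0 = p"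
    by (rule circle_walk_through[OF i pf]) blast
  obtain s where s: "s \<in> {1, -1}" "\<forall>\<^sub>F \<tau> in at_right 0. circle_walk (c i) (r i) t s \<tau> \<notin> closure (disk k)"
    using some_side_outside[OF i k, of t 1] t p by auto
  have fr: "circle_walk (c i) (r i) t s \<tau> \<in> frontier (disk i)" for \<tau>
    using r_pos[OF i] frontier_disk[OF i] by simp
  obtain V where V: "open V" "rel_int i (Gam_int i) = frontier (disk i) \<inter> V"
    using openin_rel_int[of i "Gam_int i"] unfolding openin_open by blast
  have lim: "(circle_walk (c i) (r i) t s \<longlongrightarrow> p) (at_right 0)"
    using tendsto_circle_walk[of "c i" "r i" t s] t by simp
  have ev: "\<forall>\<^sub>F \<tau> in at_right 0. circle_walk (c i) (r i) t s \<tau> \<in> rel_int i (Gam_int i)"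
    using topological_tendstoD[OF lim V(1)] p V fr by auto
  have "((\<lambda>\<tau>. chi i k (circle_walk (c i) (r i) t s \<tau>)) \<longlongrightarrow> chi i k p) (at_right 0)"
    by (rule continuous_on_tendsto_compose[OF chi_continuous[OF i k] lim p(1) ev])
  moreover have "\<forall>\<^sub>F \<tau> in at_right 0. chi i k (circle_walk (c i) (r i) t s \<tau>) = 0"
    using s(2) eventually_circle_walk_notin_finite[OF r_pos[OF i] s(1) finite_crossings, of "c i" t]
    by eventually_elim (rule chi_outside[OF i k fr])
  then have "((\<lambda>\<tau>. chi i k (circle_walk (c i) (r i) t s \<tau>)) \<longlongrightarrow> 0) (at_right 0)"
    by (rule tendsto_eventually)
  ultimately show ?thesis
    by (intro tendsto_unique[of "at_right (0 :: real)"]) auto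
qed

end

context disk_domain
begin

section \<open>The layers exhaust the family\<close>

text \<open>
  The boundary of the union cannot be contained in the finite set of crossings, because the
  complement of a finite set in the plane is connected and meets both the union and its
  complement. At a boundary point off the crossings a whole arc of a single circle belongs to the
  boundary.
\<close>
lemma boundary_nodes_nonempty:
  assumes W: "W \<subseteq> {1..N}" "W \<noteq> {}"
  shows "boundary_nodes W \<noteq> {}"
proof -
  define U where "U = (\<Union>l\<in>W. disk l)"
  have finW: "finite W"
    using W(1) finite_subset by auto
  have "open U"
    unfolding U_def by (intro open_UN ballI open_disk)
  have "bounded U"
    unfolding U_def using finW by (intro bounded_UN) (simp_all add: disk_def)
  obtain l where l: "l \<in> W"
    using W by blast
  then have "c l \<in> disk l" "disk l \<subseteq> U"
    using r_pos W by (auto simp: disk_def U_def)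
  then have "infinite U"
    using \<open>open U\<close> by (metis equals0D infinite_super open_disk finite_imp_not_open)
  then have "- crossings \<inter> U \<noteq> {}"
    using finite_crossings finite_subset[of U crossings] by blast
  moreover have "- crossings - U \<noteq> {}"
  proof
    assume "- crossings - U = {}"
    then have "UNIV \<subseteq> crossings \<union> U"
      by blast
    then have "bounded (UNIV :: complex set)"
      using \<open>bounded U\<close> finite_crossings by (metis bounded_Un bounded_subset finite_imp_bounded)
    then show False
      using not_bounded_UNIV by blast
  qed
  moreover have "connected (- crossings)"
  proof (intro path_connected_imp_connected path_connected_complement_countable)
    show "2 \<le> DIM(complex)" "countable crossings"
      using finite_crossings countable_finite by auto
  qed
  ultimately have "- crossings \<inter> frontier U \<noteq> {}"
    by (intro connected_Int_frontier)
  then obtain x where x: "x \<notin> crossings" "x \<in> frontier U"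
    by blast
  then have xU: "x \<notin> U" "x \<in> closure U"
    unfolding frontier_def interior_open[OF \<open>open U\<close>] by auto
  have "closure U \<subseteq> (\<Union>l\<in>W. closure (disk l))"
    unfolding U_def using finW closure_subset by (intro closure_minimal closed_UN) auto
  then obtain i where i: "i \<in> W" "x \<in> closure (disk i)"
    using xU by blast
  have iN: "i \<in> {1..N}"
    using i W by blast
  have "x \<notin> disk i"
    using i(1) xU(1) by (auto simp: U_def)
  then have xi: "x \<in> frontier (disk i)"
    using i(2) unfolding frontier_def interior_open[OF open_disk] by blast
  define V where "V = (\<Inter>k\<in>W - {i}. - closure (disk k))"
  have "open V"
    unfolding V_def using finW by (intro open_INT) auto
  moreover have "x \<in> V"
    unfolding V_def
  proof
    fix k assume k: "k \<in> W - {i}"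
    have "x \<notin> disk k"
      using k xU(1) by (auto simp: U_def)
    moreover have "k \<in> {1..N}" "k \<noteq> i"
      using k W(1) by auto
    ultimately show "x \<in> - closure (disk k)"
      using off_crossings[OF iN _ _ xi x(1)] by blast
  qed
  moreover have "x \<in> sphere (c i) (r i)"
    using xi frontier_disk[OF iN] by blast
  moreover have "V \<inter> sphere (c i) (r i) \<subseteq> frontier (disk i) \<inter> frontier U"
  proof
    fix z assume z: "z \<in> V \<inter> sphere (c i) (r i)"
    then have zi: "z \<in> frontier (disk i)"
      using frontier_disk[OF iN] by blast
    have "z \<notin> disk l" if "l \<in> W" for l
    proof (cases "l = i")
      case True
      then show ?thesis
        using zi unfolding frontier_def interior_open[OF open_disk] by blast
    next
      case False
      then show ?thesis
        using z that closure_subset[of "disk l"] unfolding V_def by blast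
    qed
    then have "z \<notin> U"
      by (simp add: U_def)
    moreover have "z \<in> closure U"
      using zi i(1) closure_mono[of "disk i" U] unfolding frontier_def U_def by blast
    ultimately show "z \<in> frontier (disk i) \<inter> frontier U"
      using zi unfolding frontier_def[of U] interior_open[OF \<open>open U\<close>] by blast
  qed
  moreover have "frontier (disk i) \<inter> frontier U \<in> sets borel"
    by (intro borel_closed closed_Int frontier_closed)
  ultimately have "0 < emeasure (arclength i) (frontier (disk i) \<inter> frontier U)"
    unfolding arclength_def using r_pos[OF iN] by (intro emeasure_circle_arclength_pos) auto
  then have "i \<in> boundary_nodes W"
    using i(1) by (simp add: boundary_nodes_def U_def)
  then show ?thesis
    by blast
qed

text \<open>
  The sets \<open>R m\<close> of disks that remain before the choice of layer \<open>m\<close> decrease strictly until they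
  are empty, so the number of nonempty ones is an upper bound for the index of every nonempty layer.
\<close>
lemma every_disk_in_some_layer:
  assumes i: "i \<in> {1..N}"
  shows "\<exists>m. 1 \<le> m \<and> m \<le> num_layers \<and> i \<in> layer m"
proof -
  define R where "R = (\<lambda>m. {1..N} - (\<Union>k\<in>{1..<m}. layer k))"
  have RN: "R m \<subseteq> {1..N}" for m
    by (auto simp: R_def)
  have layer_R: "layer m = boundary_nodes (R m)" for m
    by (subst layer.simps) (simp add: R_def)
  have layer_sub: "layer m \<subseteq> R m" for m
    unfolding layer_R boundary_nodes_def by blast
  have R_Suc: "R (Suc (Suc m)) = R (Suc m) - layer (Suc m)" for m
    unfolding R_def by (auto simp: less_Suc_eq)
  have mono: "R n \<subseteq> R m" if "m \<le> n" for m n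
    using that unfolding R_def by (intro Diff_mono UN_mono) auto
  have "card (R (Suc m)) \<le> N - m" for m
  proof (induction m)
    case 0
    show ?case
      by (simp add: R_def)
  next
    case (Suc m)
    show ?case
    proof (cases "R (Suc m) = {}")
      case True
      then show ?thesis
        by (simp add: R_Suc)
    next
      case False
      then have "layer (Suc m) \<noteq> {}"
        unfolding layer_R by (intro boundary_nodes_nonempty RN)
      then have "R (Suc (Suc m)) \<subset> R (Suc m)"
        using layer_sub[of "Suc m"] unfolding R_Suc by blast
      then have "card (R (Suc (Suc m))) < card (R (Suc m))"
        by (intro psubset_card_mono finite_subset[OF RN]) auto
      then show ?thesis
        using Suc by linarith
    qed
  qed
  from this[of N] have empty: "R (Suc N) = {}"
    using finite_subset[OF RN finite_atLeastAtMost] by simp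
  then obtain k where k: "1 \<le> k" "k \<le> N" "i \<in> layer k"
    using i unfolding R_def by fastforce
  have le_N: "m \<le> N" if "R m \<noteq> {}" for m
  proof (rule ccontr)
    assume "\<not> m \<le> N"
    then show False
      using mono[of "Suc N" m] empty that by auto
  qed
  have "{m. 1 \<le> m \<and> R m \<noteq> {}} \<subseteq> {1..N}"
    unfolding atLeastAtMost_def atLeast_def atMost_def using le_N by blast
  then have fin: "finite {m. 1 \<le> m \<and> R m \<noteq> {}}"
    by (rule finite_subset) simp
  have "{1..k} \<subseteq> {m. 1 \<le> m \<and> R m \<noteq> {}}"
    using mono layer_sub[of k] k(3) by fastforce
  then have "card {1..k} \<le> card {m. 1 \<le> m \<and> R m \<noteq> {}}"
    by (rule card_mono[OF fin])
  then have "k \<le> num_layers"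
    by (simp add: num_layers_def R_def)
  then show ?thesis
    using k by blast
qed

end

context disk_partition_of_unity
begin

section \<open>Majorants of the iterates\<close>

text \<open>
  The operator integrates over \<open>Skel2 j i\<close>, which up to finitely many points is contained in the set
  used here. On the latter both \<open>chi i j\<close> and the functions \<open>w j\<close> of interest are continuous, which
  makes the datum Borel measurable.
\<close>
definition datum :: "nat \<Rightarrow> (nat \<Rightarrow> complex \<Rightarrow> real) \<Rightarrow> complex \<Rightarrow> real" where
  "datum i w y =
     (\<Sum>j\<in>nbrs i. indicator (frontier (disk i) \<inter> disk j) y * (chi i j y * w j y))"

primrec majorant :: "nat \<Rightarrow> nat \<Rightarrow> complex \<Rightarrow> real" where
  "majorant 0 = (\<lambda>i x. 1)"
| "majorant (Suc n) = (\<lambda>i. poisson (c i) (r i) (datum i (majorant n)))"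

text \<open>The properties that pass from one majorant to the next.\<close>
definition admissible :: "(nat \<Rightarrow> complex \<Rightarrow> real) \<Rightarrow> bool" where
  "admissible w \<longleftrightarrow>
     (\<forall>j\<in>{1..N}. continuous_on (disk j) (w j) \<and> (\<forall>x\<in>disk j. 0 \<le> w j x \<and> w j x \<le> 1))"

lemma admissibleD:
  assumes "admissible w" "j \<in> {1..N}"
  shows "continuous_on (disk j) (w j)" "\<And>x. x \<in> disk j \<Longrightarrow> 0 \<le> w j x" "\<And>x. x \<in> disk j \<Longrightarrow> w j x \<le> 1"
  using assms by (auto simp: admissible_def)

lemma datum_term_measurable:
  assumes i: "i \<in> {1..N}" and j: "j \<in> nbrs i" and w: "admissible w"
  shows "(\<lambda>y. indicator (frontier (disk i) \<inter> disk j) y * (chi i j y * w j y)) \<in> borel_measurable borel"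
proof -
  have jN: "j \<in> {1..N}"
    by (rule subsetD[OF nbrs_subset j])
  have "frontier (disk i) \<inter> disk j \<subseteq> rel_int i (Gam_int i)"
    using in_disk_imp_rel_int_Gam_int jN by blast
  then have "continuous_on (frontier (disk i) \<inter> disk j) (\<lambda>y. chi i j y * w j y)"
    by (intro continuous_on_mult continuous_on_subset[OF chi_continuous[OF i j]]
        continuous_on_subset[OF admissibleD(1)[OF w jN]]) auto
  from borel_measurable_continuous_on_indicator[OF _ this]
  show ?thesis
    by (simp add: borel_closed borel_open sets.Int)
qed

lemma datum_measurable:
  assumes "i \<in> {1..N}" "admissible w"
  shows "datum i w \<in> borel_measurable borel"
  unfolding datum_def using assms by (intro borel_measurable_sum datum_term_measurable)

lemma chi_sum_in_disk:
  assumes "i \<in> {1..N}" "y \<in> frontier (disk i)" "y \<in> disk l" "l \<in> {1..N}"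
  shows "(\<Sum>j\<in>nbrs i. chi i j y) = 1"
  using chi_sum[OF assms(1) in_disk_imp_rel_int_Gam_int[OF assms(2-4)]] .

lemma datum_outside:
  assumes "\<And>j. j \<in> nbrs i \<Longrightarrow> y \<notin> disk j"
  shows "datum i w y = 0"
  unfolding datum_def using assms by (intro sum.neutral) auto

lemma datum_bounds:
  assumes i: "i \<in> {1..N}" and w: "admissible w"
  shows "0 \<le> datum i w y" "datum i w y \<le> 1"
proof -
  have "0 \<le> datum i w y \<and> datum i w y \<le> 1"
  proof (cases "y \<in> frontier (disk i) \<and> (\<exists>l\<in>nbrs i. y \<in> disk l)")
    case False
    then have "datum i w y = 0"
      unfolding datum_def by (intro sum.neutral) auto
    then show ?thesis
      by simp
  next
    case True
    then obtain l where y: "y \<in> frontier (disk i)" and l: "l \<in> nbrs i" "y \<in> disk l"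
      by blast
    have lN: "l \<in> {1..N}"
      by (rule subsetD[OF nbrs_subset l(1)])
    have *: "0 \<le> indicator (frontier (disk i) \<inter> disk j) y * (chi i j y * w j y) \<and>
        indicator (frontier (disk i) \<inter> disk j) y * (chi i j y * w j y) \<le> chi i j y"
      if "j \<in> nbrs i" for j
      using chi_nonneg[OF i that y l(2) lN] admissibleD(2,3)[OF w subsetD[OF nbrs_subset that], of y]
      by (auto simp: indicator_def mult_left_le)
    have "datum i w y \<le> (\<Sum>j\<in>nbrs i. chi i j y)"
      unfolding datum_def using * by (intro sum_mono) blast
    moreover have "0 \<le> datum i w y"
      unfolding datum_def using * by (intro sum_nonneg) blast
    ultimately show ?thesis
      unfolding chi_sum_in_disk[OF i y l(2) lN] by blast
  qed
  then show "0 \<le> datum i w y" "datum i w y \<le> 1"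
    by auto
qed

text \<open>A convex combination of numbers at most 1 is below 1 if all entries with positive weight are.\<close>
lemma datum_less_1:
  assumes i: "i \<in> {1..N}" and w: "admissible w" and y: "y \<in> frontier (disk i)"
    and less: "\<And>j. j \<in> nbrs i \<Longrightarrow> y \<in> disk j \<Longrightarrow> w j y < 1"
  shows "datum i w y < 1"
proof (cases "\<exists>l\<in>nbrs i. y \<in> disk l")
  case False
  then show ?thesis
    using datum_outside by auto
next
  case True
  then obtain l where l: "l \<in> nbrs i" "y \<in> disk l"
    by blast
  have lN: "l \<in> {1..N}"
    by (rule subsetD[OF nbrs_subset l(1)])
  note nonneg = chi_nonneg[OF i _ y l(2) lN]
  note sum1 = chi_sum_in_disk[OF i y l(2) lN]
  have "\<exists>k\<in>nbrs i. chi i k y \<noteq> 0"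
    using sum1 by (metis sum.neutral zero_neq_one)
  then obtain k where k: "k \<in> nbrs i" "chi i k y > 0"
    using nonneg y by (metis order_le_less)
  have "datum i w y < (\<Sum>j\<in>nbrs i. chi i j y)"
    unfolding datum_def
  proof (rule sum_strict_mono_ex1)
    show "\<forall>j\<in>nbrs i. indicator (frontier (disk i) \<inter> disk j) y * (chi i j y * w j y) \<le> chi i j y"
    proof
      fix j assume j: "j \<in> nbrs i"
      show "indicator (frontier (disk i) \<inter> disk j) y * (chi i j y * w j y) \<le> chi i j y"
        using nonneg[OF j] less[OF j] by (auto simp: indicator_def mult_left_le)
    qed
    show "\<exists>j\<in>nbrs i. indicator (frontier (disk i) \<inter> disk j) y * (chi i j y * w j y) < chi i j y"
      using k less[OF k(1)] by (intro bexI[of _ k]) (auto simp: indicator_def)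
  qed simp
  then show ?thesis
    using sum1 by simp
qed

lemma admissible_poisson_datum:
  assumes w: "admissible w"
  shows "admissible (\<lambda>i. poisson (c i) (r i) (datum i w))"
  unfolding admissible_def
proof (intro ballI conjI)
  fix i assume i: "i \<in> {1..N}"
  note d = datum_measurable[OF i w] datum_bounds[OF i w]
  show "continuous_on (disk i) (poisson (c i) (r i) (datum i w))"
    unfolding disk_def by (intro continuous_on_poisson integrable_bounded_circle d)
  fix x assume "x \<in> disk i"
  then have x: "x \<in> ball (c i) (r i)"
    by (simp add: disk_def)
  show "0 \<le> poisson (c i) (r i) (datum i w) x" "poisson (c i) (r i) (datum i w) x \<le> 1"
    using poisson_nonneg[OF x] poisson_le_1[OF x] d by blast+
qed

lemma admissible_majorant: "admissible (majorant n)"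
proof (induction n)
  case 0
  show ?case
    by (simp add: admissible_def)
next
  case (Suc n)
  then show ?case
    by (simp add: admissible_poisson_datum)
qed

text \<open>
  A point of the circle on the boundary of the union of the remaining disks lies in none of them.
  So the datum there only involves disks from earlier layers, whose majorants are already below 1.
\<close>
lemma majorant_less_1_on_layer:
  assumes "i \<in> layer m" "1 \<le> m" "m \<le> n" "x \<in> disk i"
  shows "majorant n i x < 1"
  using assms
proof (induction m arbitrary: i n x rule: less_induct)
  case (less m)
  define W where "W = {1..N} - (\<Union>k\<in>{1..<m}. layer k)"
  have "layer m = boundary_nodes W"
    by (subst layer.simps) (simp add: W_def)
  then have iW: "i \<in> W" and pos: "0 < emeasure (arclength i) (frontier (disk i) \<inter> frontier (\<Union>l\<in>W. disk l))"
    using less.prems(1) by (auto simp: boundary_nodes_def)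
  have i: "i \<in> {1..N}"
    using iW by (simp add: W_def)
  obtain n' where n: "n = Suc n'"
    using less.prems by (cases n) auto
  have "datum i (majorant n') y < 1" if y: "y \<in> frontier (disk i) \<inter> frontier (\<Union>l\<in>W. disk l)" for y
  proof (rule datum_less_1[OF i admissible_majorant])
    show "y \<in> frontier (disk i)"
      using y by blast
    fix j assume j: "j \<in> nbrs i" "y \<in> disk j"
    have jN: "j \<in> {1..N}"
      by (rule subsetD[OF nbrs_subset j(1)])
    have "open (\<Union>l\<in>W. disk l)"
      by (intro open_UN ballI open_disk)
    then have "y \<notin> (\<Union>l\<in>W. disk l)"
      using y by (auto simp: frontier_def interior_open)
    then have "j \<notin> W"
      using j by blast
    then obtain k where "k \<in> {1..<m}" "j \<in> layer k"
      using jN unfolding W_def by blast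
    then show "majorant n' j y < 1"
      using less.IH[of k j n' y] less.prems(3) j(2) n by auto
  qed
  then have AE: "AE y in circle_arclength (c i) (r i).
      y \<in> frontier (disk i) \<inter> frontier (\<Union>l\<in>W. disk l) \<longrightarrow> datum i (majorant n') y < 1"
    by auto
  have x: "x \<in> ball (c i) (r i)"
    using less.prems by (simp add: disk_def)
  have "frontier (disk i) \<inter> frontier (\<Union>l\<in>W. disk l) \<in> sets borel"
    by (intro borel_closed closed_Int frontier_closed)
  from poisson_less_1[OF x datum_measurable[OF i admissible_majorant] datum_bounds[OF i admissible_majorant] this _ AE]
  show ?case
    using pos by (simp add: n arclength_def)
qed

lemma majorant_num_layers_less_1:
  assumes "i \<in> {1..N}" "x \<in> disk i" "num_layers \<le> n"
  shows "majorant n i x < 1"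
  using every_disk_in_some_layer[OF assms(1)] majorant_less_1_on_layer assms(2,3) by fastforce

section \<open>A uniform gap on the skeletons\<close>

text \<open>
  The function \<open>E\<close> in the proof bounds the datum near \<open>p\<close> and is continuous at \<open>p\<close>: the
  majorants are kept only for disks that contain \<open>p\<close> and replaced by 1 for the others. This does no
  harm at \<open>p\<close> itself, because the weights of the other disks vanish there.
\<close>
lemma datum_gap_near_interior_point:
  assumes i: "i \<in> {1..N}" and w: "admissible w" and p: "p \<in> rel_int i (Gam_int i)"
    and less: "\<And>j x. j \<in> {1..N} \<Longrightarrow> x \<in> disk j \<Longrightarrow> w j x < 1"
  obtains V e where "open V" "p \<in> V" "0 < e" "\<And>y. y \<in> V \<Longrightarrow> y \<in> frontier (disk i) \<Longrightarrow> datum i w y \<le> 1 - e"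
proof -
  have nN: "j \<in> {1..N}" if "j \<in> nbrs i" for j
    by (rule subsetD[OF nbrs_subset that])
  have pf: "p \<in> frontier (disk i)"
    using p rel_int_iff by blast
  have sum1: "(\<Sum>j\<in>nbrs i. chi i j p) = 1"
    by (rule chi_sum[OF i p])
  have "\<exists>j\<in>nbrs i. chi i j p \<noteq> 0"
    using sum1 by (metis sum.neutral zero_neq_one)
  then obtain l where l: "l \<in> nbrs i" "p \<in> disk l"
    using chi_zero_at_interior_point[OF i _ p] by blast
  define E where "E = (\<lambda>y. \<Sum>j\<in>nbrs i. chi i j y * (if p \<in> disk j then w j y else 1))"
  define D where "D = (\<Inter>j\<in>{j\<in>nbrs i. p \<in> disk j}. disk j)"
  have D: "open D" "p \<in> D"
    unfolding D_def by (auto intro!: open_INT)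
  obtain V0 where V0: "open V0" "rel_int i (Gam_int i) = frontier (disk i) \<inter> V0"
    using openin_rel_int[of i "Gam_int i"] unfolding openin_open by blast
  have cont: "continuous_on (rel_int i (Gam_int i) \<inter> D) E"
    unfolding E_def
  proof (intro continuous_on_sum continuous_on_mult)
    fix j assume j: "j \<in> nbrs i"
    show "continuous_on (rel_int i (Gam_int i) \<inter> D) (chi i j)"
      by (rule continuous_on_subset[OF chi_continuous[OF i j]]) auto
    show "continuous_on (rel_int i (Gam_int i) \<inter> D) (\<lambda>y. if p \<in> disk j then w j y else 1)"
    proof (cases "p \<in> disk j")
      case True
      then have "D \<subseteq> disk j"
        using j by (auto simp: D_def)
      then show ?thesis
        using True by (simp add: continuous_on_subset[OF admissibleD(1)[OF w nN[OF j]]] le_infI2)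
    qed simp
  qed
  have "E p < (\<Sum>j\<in>nbrs i. chi i j p)"
    unfolding E_def
  proof (rule sum_strict_mono_ex1)
    have *: "0 \<le> chi i j p" if "j \<in> nbrs i" for j
      using chi_nonneg[OF i that pf l(2) nN[OF l(1)]] .
    show "\<forall>j\<in>nbrs i. chi i j p * (if p \<in> disk j then w j p else 1) \<le> chi i j p"
      using * admissibleD(3)[OF w nN] by (auto simp: mult_left_le)
    have "\<exists>j\<in>nbrs i. chi i j p \<noteq> 0"
      using sum1 by (metis sum.neutral zero_neq_one)
    then obtain j where j: "j \<in> nbrs i" "chi i j p \<noteq> 0"
      by blast
    then have pj: "p \<in> disk j"
      using chi_zero_at_interior_point[OF i _ p] by blast
    have "chi i j p * w j p < chi i j p * 1"
      using *[OF j(1)] j(2) less[OF nN[OF j(1)] pj] by (intro mult_strict_left_mono) auto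
    then show "\<exists>j\<in>nbrs i. chi i j p * (if p \<in> disk j then w j p else 1) < chi i j p"
      using j pj by (intro bexI[of _ j]) auto
  qed simp
  then have Ep: "E p < 1"
    using sum1 by simp
  define e where "e = (1 - E p) / 2"
  have e: "0 < e" "E p < 1 - e"
    using Ep by (simp_all add: e_def field_simps)
  have "(E \<longlongrightarrow> E p) (at p within (rel_int i (Gam_int i) \<inter> D))"
    using cont p D by (auto simp: continuous_on_def)
  from order_tendstoD(2)[OF this e(2)]
  obtain V1 where V1: "open V1" "p \<in> V1"
      "\<And>y. y \<in> V1 \<Longrightarrow> y \<noteq> p \<Longrightarrow> y \<in> rel_int i (Gam_int i) \<inter> D \<Longrightarrow> E y < 1 - e"
    unfolding eventually_at_topological by blast
  show ?thesis
  proof (rule that[of "V0 \<inter> V1 \<inter> D" e])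
    show "open (V0 \<inter> V1 \<inter> D)" "p \<in> V0 \<inter> V1 \<inter> D" "0 < e"
      using V0 V1 D p e by auto
    fix y assume y: "y \<in> V0 \<inter> V1 \<inter> D" "y \<in> frontier (disk i)"
    then have "E y \<le> 1 - e"
      using V1(3)[of y] e V0(2) by (cases "y = p") auto
    moreover have "datum i w y \<le> E y"
      unfolding datum_def E_def
    proof (rule sum_mono)
      fix j assume j: "j \<in> nbrs i"
      have "y \<in> disk l"
        using y l by (auto simp: D_def)
      then have "0 \<le> chi i j y"
        using chi_nonneg[OF i j y(2) _ nN[OF l(1)]] by blast
      moreover have "y \<in> disk j" if "p \<in> disk j"
        using that j y by (auto simp: D_def)
      ultimately show "indicator (frontier (disk i) \<inter> disk j) y * (chi i j y * w j y)
          \<le> chi i j y * (if p \<in> disk j then w j y else 1)"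
        using admissibleD(2,3)[OF w nN[OF j], of y] by (auto simp: indicator_def mult_left_le)
    qed
    ultimately show "datum i w y \<le> 1 - e"
      by linarith
  qed
qed

text \<open>
  If both sides of the point were locally covered by some disk, a punctured neighbourhood of it in
  the circle would avoid the outer boundary, and the point would be interior to the inner boundary.
\<close>
lemma some_side_exterior:
  assumes i: "i \<in> {1..N}" and p: "circle_walk (c i) (r i) t s0 0 \<notin> rel_int i (Gam_int i)"
  shows "\<exists>s\<in>{1, -1}. \<forall>k\<in>nbrs i. \<forall>\<^sub>F \<tau> in at_right 0. circle_walk (c i) (r i) t s \<tau> \<notin> closure (disk k)"
proof (rule ccontr)
  let ?p = "circle_walk (c i) (r i) t s0 0"
  assume "\<not> ?thesis"
  then have *: "\<exists>k\<in>nbrs i. \<forall>\<^sub>F \<tau> in at_right 0. circle_walk (c i) (r i) t s \<tau> \<in> disk k" if "s \<in> {1, -1}" for s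
    using side_dichotomy[OF i _ that] that by blast
  have **: "\<exists>e>0. \<forall>\<tau>. 0 < \<tau> \<longrightarrow> \<tau> < e \<longrightarrow> circle_walk (c i) (r i) t s \<tau> \<in> frontier (disk i) - Gam_ext i"
    if s: "s \<in> {1, -1}" for s
  proof -
    obtain k where k: "k \<in> nbrs i" "\<forall>\<^sub>F \<tau> in at_right 0. circle_walk (c i) (r i) t s \<tau> \<in> disk k"
      using *[OF s] by blast
    then obtain e where "e > 0" "\<forall>\<tau>>0. \<tau> < e \<longrightarrow> circle_walk (c i) (r i) t s \<tau> \<in> disk k"
      by (auto simp: eventually_at_right[of 0 1])
    moreover have "circle_walk (c i) (r i) t s \<tau> \<in> frontier (disk i)" for \<tau>
      using r_pos[OF i] frontier_disk[OF i] by simp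
    ultimately show ?thesis
      using Gam_ext_not_in_disk subsetD[OF nbrs_subset k(1)] by (intro exI[of _ e]) blast
  qed
  obtain e1 where e1: "e1 > 0" "\<And>\<tau>. 0 < \<tau> \<Longrightarrow> \<tau> < e1 \<Longrightarrow> circle_walk (c i) (r i) t 1 \<tau> \<in> frontier (disk i) - Gam_ext i"
    using **[of 1] by auto
  obtain e2 where e2: "e2 > 0" "\<And>\<tau>. 0 < \<tau> \<Longrightarrow> \<tau> < e2 \<Longrightarrow> circle_walk (c i) (r i) t (-1) \<tau> \<in> frontier (disk i) - Gam_ext i"
    using **[of "-1"] by auto
  have "0 < min e1 e2"
    using e1 e2 by simp
  obtain V where V: "open V" "?p \<in> V"
    "\<And>y. y \<in> V \<Longrightarrow> y \<in> sphere (c i) (r i) \<Longrightarrow> y \<noteq> ?p \<Longrightarrow>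
      \<exists>s\<in>{1, -1}. \<exists>\<tau>. 0 < \<tau> \<and> \<tau> < min e1 e2 \<and> y = circle_walk (c i) (r i) t s \<tau>"
    using circle_near_point[OF r_pos[OF i] \<open>0 < min e1 e2\<close>, of "c i" t s0] by metis
  have "?p \<in> Gam_int i"
  proof (rule Lim_in_closed_set)
    show "closed (Gam_int i)"
      by (simp add: Gam_int_def)
    have "circle_walk (c i) (r i) t 1 0 = ?p"
      by (simp add: circle_walk_def)
    then show "(circle_walk (c i) (r i) t 1 \<longlongrightarrow> ?p) (at_right 0)"
      using tendsto_circle_walk[of "c i" "r i" t 1] by simp
    show "\<forall>\<^sub>F \<tau> in at_right 0. circle_walk (c i) (r i) t 1 \<tau> \<in> Gam_int i"
      unfolding Gam_int_def eventually_at_right[OF zero_less_one]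
      using e1 closure_subset by blast
  qed simp
  moreover have "y \<in> Gam_int i" if "y \<in> V" "y \<in> frontier (disk i)" "y \<noteq> ?p" for y
  proof -
    have "y \<in> frontier (disk i) - Gam_ext i"
      using V(3)[OF that(1) _ that(3)] that(2) frontier_disk[OF i] e1(2) e2(2) by fastforce
    then show ?thesis
      using closure_subset unfolding Gam_int_def by blast
  qed
  ultimately have "V \<inter> frontier (disk i) \<subseteq> Gam_int i"
    by blast
  moreover have "?p \<in> frontier (disk i)"
    using r_pos[OF i] frontier_disk[OF i] by simp
  ultimately have "?p \<in> rel_int i (Gam_int i)"
    unfolding rel_int_iff using V(1,2) by blast
  with p show False
    by blast
qed

lemma datum_gap_on_one_side:
  assumes i: "i \<in> {1..N}" and w: "admissible w"
    and less: "\<And>j x. j \<in> {1..N} \<Longrightarrow> x \<in> disk j \<Longrightarrow> w j x < 1"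
  shows "\<exists>s\<in>{1, -1}. \<exists>e>0. \<forall>\<^sub>F \<tau> in at_right 0. datum i w (circle_walk (c i) (r i) t s \<tau>) \<le> 1 - e"
proof (cases "circle_walk (c i) (r i) t 1 0 \<in> rel_int i (Gam_int i)")
  case True
  obtain V e where V: "open V" "circle_walk (c i) (r i) t 1 0 \<in> V" "0 < e"
      "\<And>y. y \<in> V \<Longrightarrow> y \<in> frontier (disk i) \<Longrightarrow> datum i w y \<le> 1 - e"
    by (rule datum_gap_near_interior_point[OF i w True less]) blast+
  have "\<forall>\<^sub>F \<tau> in at_right 0. circle_walk (c i) (r i) t 1 \<tau> \<in> V"
    by (rule topological_tendstoD[OF tendsto_circle_walk V(1,2)])
  then have "\<forall>\<^sub>F \<tau> in at_right 0. datum i w (circle_walk (c i) (r i) t 1 \<tau>) \<le> 1 - e"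
    by eventually_elim (use V(4) r_pos[OF i] frontier_disk[OF i] in simp)
  then show ?thesis
    using V(3) by blast
next
  case False
  obtain s :: real where s: "s \<in> {1, -1}"
      "\<forall>k\<in>nbrs i. \<forall>\<^sub>F \<tau> in at_right 0. circle_walk (c i) (r i) t s \<tau> \<notin> closure (disk k)"
    using some_side_exterior[OF i False] by blast
  then have "\<forall>\<^sub>F \<tau> in at_right 0. \<forall>k\<in>nbrs i. circle_walk (c i) (r i) t s \<tau> \<notin> closure (disk k)"
    by (intro eventually_ball_finite) auto
  then have "\<forall>\<^sub>F \<tau> in at_right 0. datum i w (circle_walk (c i) (r i) t s \<tau>) \<le> 1 - 1"
  proof eventually_elim
    case (elim \<tau>)
    then have "datum i w (circle_walk (c i) (r i) t s \<tau>) = 0"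
      using closure_subset by (intro datum_outside) blast
    then show ?case
      by simp
  qed
  then show ?thesis
    using s(1) zero_less_one by blast
qed

text \<open>
  For \<open>x\<close> on circle \<open>k\<close> at distance \<open>u\<close> from the crossing \<open>p\<close>, transversality makes the power of \<open>x\<close>
  with respect to circle \<open>i\<close> at least a multiple of \<open>u\<close>, while points \<open>y\<close> of circle \<open>i\<close> within
  distance \<open>u\<close> of \<open>p\<close> satisfy \<open>norm (x - y) \<le> 2 * u\<close>. So the kernel is at least a multiple of
  \<open>1 / u\<close> on an arc of length \<open>u\<close> to the good side of \<open>p\<close>, and the harmonic measure of this arc is
  bounded from below independently of \<open>u\<close>.
\<close>
lemma poisson_gap_near_crossing:
  assumes i: "i \<in> {1..N}" and k: "k \<in> nbrs i" and w: "admissible w"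
    and less: "\<And>j x. j \<in> {1..N} \<Longrightarrow> x \<in> disk j \<Longrightarrow> w j x < 1"
    and p: "p \<in> frontier (disk i)" "p \<in> frontier (disk k)"
  obtains V e where "open V" "p \<in> V" "0 < e"
    "\<And>x. x \<in> V \<Longrightarrow> x \<in> frontier (disk k) \<Longrightarrow> x \<in> disk i \<Longrightarrow> poisson (c i) (r i) (datum i w) x \<le> 1 - e"
proof -
  have kN: "k \<in> {1..N}"
    by (rule subsetD[OF nbrs_subset k])
  have ri: "0 < r i" and rk: "0 < r k"
    using r_pos i kN by auto
  have "norm (p - c i) = r i"
    using p frontier_disk[OF i] by (simp add: dist_norm norm_minus_commute)
  then obtain t0 where t0: "0 \<le> t0" "t0 < 2 * pi" "p = c i + of_real (r i) * cis t0"
    by (rule circle_param_right)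
  obtain s d where s: "s \<in> {1, -1}" and d: "d > 0"
      and small: "\<forall>\<^sub>F \<tau> in at_right 0. datum i w (circle_walk (c i) (r i) t0 s \<tau>) \<le> 1 - d"
    using datum_gap_on_one_side[OF i w less] by blast
  \<comment> \<open>To walk backwards from angle 0 inside one period, one has to start from \<open>2 * pi\<close>.\<close>
  define t where "t = (if s = -1 \<and> t0 = 0 then 2 * pi else t0)"
  have walk_t: "circle_walk (c i) (r i) t0 s \<tau> = circle_walk (c i) (r i) t s \<tau>" for \<tau>
    by (auto simp: circle_walk_def t_def cis_mult[symmetric])
  have walk0: "circle_walk (c i) (r i) t s 0 = p"
    using t0 by (simp add: walk_t[symmetric]) (simp add: circle_walk_def)
  obtain e0 where e0: "e0 > 0" "\<And>\<tau>. 0 < \<tau> \<Longrightarrow> \<tau> < e0 \<Longrightarrow> datum i w (circle_walk (c i) (r i) t s \<tau>) \<le> 1 - d"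
    using small by (auto simp: eventually_at_right[of 0 1] walk_t)
  define e1 where "e1 = (if s = 1 then 2 * pi - t else t)"
  have e1: "0 < e1"
    using s t0 by (auto simp: e1_def t_def)
  have range: "{0..<2 * pi} \<supseteq> (if s = 1 then {t<..<t + \<eta>} else {t - \<eta><..<t})" if "\<eta> \<le> e1" for \<eta>
    using that s t0 by (auto simp: e1_def t_def split: if_splits)
  define v where "v = c k - c i"
  define b where "b = \<bar>Im (cnj (p - c k) * v)\<bar>"
  have "Im (cnj (p - c k) * (c i - c k)) \<noteq> 0"
    using neighbours_transversal[OF kN nbrs_sym[OF k i]] p by blast
  moreover have "cnj (p - c k) * (c i - c k) = - (cnj (p - c k) * v)"
    by (simp add: v_def algebra_simps)
  ultimately have b: "0 < b"
    unfolding b_def by (metis neg_equal_0_iff_equal uminus_complex.sel(2) zero_less_abs_iff)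
  have "i \<noteq> k"
    using k by (auto simp: nbrs_def)
  then have v: "0 < norm v"
    using centres_distinct[OF i kN] by (simp add: v_def)
  \<comment> \<open>The first radius makes the quadratic error term at most half of the linear term in the
    lower bound for the power of \<open>x\<close>; the other two keep the arc within the good side and within
    one period.\<close>
  define V where "V = ball p (min (b / norm v) (min (r i * e0) (r i * e1)))"
  show ?thesis
  proof (rule that[of V "b * d / (8 * pi * r i * r k)"])
    show "open V" "p \<in> V" "0 < b * d / (8 * pi * r i * r k)"
      using b v ri rk e0 e1 d by (simp_all add: V_def)
    fix x assume x: "x \<in> V" "x \<in> frontier (disk k)" "x \<in> disk i"
    define u where "u = p - x"
    define \<eta> where "\<eta> = norm u / r i"
    have xb: "x \<in> ball (c i) (r i)"
      using x by (simp add: disk_def)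
    have "x \<noteq> p"
      using x p frontier_disk[OF i] by (auto simp: disk_def)
    then have u: "0 < norm u"
      by (simp add: u_def)
    have "norm u < b / norm v" "norm u < r i * e0" "norm u < r i * e1"
      using x by (simp_all add: V_def u_def dist_norm)
    then have u1: "norm u * norm v < b" and eta: "\<eta> < e0" "\<eta> < e1" "0 < \<eta>"
      using v ri u by (simp_all add: \<eta>_def field_simps)
    have sk: "x \<in> sphere (c k) (r k)" "p \<in> sphere (c k) (r k)" "p \<in> sphere (c i) (r i)"
      using x p frontier_disk[OF i] frontier_disk[OF kN] by blast+
    have pow: "(r i)\<^sup>2 - (norm (x - c i))\<^sup>2 = 2 * (u \<bullet> v)"
      unfolding u_def v_def by (rule power_of_point_on_circle[OF sk])
    have "norm (x - c i) < r i"
      using xb by (simp add: dist_norm norm_minus_commute)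
    then have uv: "0 < u \<bullet> v"
      using pow power_strict_mono[of "norm (x - c i)" "r i" 2] by simp
    have npk: "norm (p - c k) = r k"
      using sk by (simp add: dist_norm norm_minus_commute)
    moreover have "norm ((p - c k) - u) = r k"
      using sk by (simp add: u_def dist_norm norm_minus_commute)
    ultimately have "(norm (p - c k))\<^sup>2 = (norm ((p - c k) - u))\<^sup>2"
      by simp
    then have un: "2 * (u \<bullet> (p - c k)) = (norm u)\<^sup>2"
      unfolding dot_square_norm[symmetric] inner_diff_left[of "p - c k" u] inner_diff_right[of _ "p - c k" u]
      by (simp add: inner_commute)
    have "b * norm u \<le> \<bar>u \<bullet> (p - c k)\<bar> * norm v + \<bar>u \<bullet> v\<bar> * r k"
      unfolding b_def using cross_product_bound[of "p - c k" v u] npk by simp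
    also have "\<bar>u \<bullet> (p - c k)\<bar> = (norm u)\<^sup>2 / 2"
      using un zero_le_power2[of "norm u"] by linarith
    also have "(norm u)\<^sup>2 / 2 * norm v = norm u * (norm u * norm v) / 2"
      by (simp add: power2_eq_square)
    also have "\<dots> \<le> norm u * b / 2"
      using u1 u by (intro divide_right_mono mult_left_mono) auto
    finally have low: "b * norm u / r k \<le> 2 * (u \<bullet> v)"
      using uv rk by (simp add: field_simps)
    define \<kappa> where "\<kappa> = b / (4 * r k * norm u)"
    have ker: "\<kappa> \<le> poisson_kernel (c i) (r i) x (circle_walk (c i) (r i) t s \<tau>)" if \<tau>: "0 < \<tau>" "\<tau> < \<eta>" for \<tau>
    proof -
      let ?y = "circle_walk (c i) (r i) t s \<tau>"
      have "norm (?y - p) \<le> r i * \<tau>"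
        using norm_circle_walk_diff_le[OF ri s, of \<tau> "c i" t] \<tau> walk0 by simp
      also have "\<dots> \<le> norm u"
        using \<tau> ri by (simp add: \<eta>_def field_simps)
      finally have "norm (x - ?y) \<le> 2 * norm u"
        using norm_triangle_ineq[of "x - p" "p - ?y"] by (simp add: u_def norm_minus_commute)
      then have le: "(norm (x - ?y))\<^sup>2 \<le> (2 * norm u)\<^sup>2"
        by (intro power_mono) auto
      have "?y \<in> sphere (c i) (r i)"
        using ri by simp
      then have "x \<noteq> ?y"
        using xb by auto
      then have "0 < (norm (x - ?y))\<^sup>2"
        by simp
      have "\<kappa> = (b * norm u / r k) / (2 * norm u)\<^sup>2"
        using u rk by (simp add: \<kappa>_def power2_eq_square field_simps)
      also have "\<dots> \<le> (2 * (u \<bullet> v)) / (norm (x - ?y))\<^sup>2"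
        using low le \<open>0 < (norm (x - ?y))\<^sup>2\<close> uv by (intro frac_le) auto
      finally show ?thesis
        unfolding poisson_kernel_def pow .
    qed
    define \<alpha> where "\<alpha> = (if s = 1 then t else t - \<eta>)"
    have walk_of: "\<exists>\<tau>. 0 < \<tau> \<and> \<tau> < \<eta> \<and> c i + of_real (r i) * cis z = circle_walk (c i) (r i) t s \<tau>"
      if "z \<in> {\<alpha><..<\<alpha> + \<eta>}" for z
      using that s by (intro exI[of _ "s * (z - t)"]) (auto simp: \<alpha>_def circle_walk_def split: if_splits)
    have "poisson (c i) (r i) (datum i w) x \<le> 1 - \<kappa> * d * (\<alpha> + \<eta> - \<alpha>) / (2 * pi)"
    proof (rule poisson_le_if_small_on_arc[OF xb datum_measurable[OF i w] datum_bounds[OF i w]])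
      show "{\<alpha><..<\<alpha> + \<eta>} \<subseteq> {0..<2 * pi}"
        using range[of \<eta>] eta by (auto simp: \<alpha>_def split: if_splits)
      show "0 \<le> \<kappa>" "0 \<le> d" "\<alpha> \<le> \<alpha> + \<eta>"
        using b rk u d eta by (auto simp: \<kappa>_def)
      show "\<kappa> \<le> poisson_kernel (c i) (r i) x (c i + of_real (r i) * cis z)" if "z \<in> {\<alpha><..<\<alpha> + \<eta>}" for z
        using walk_of[OF that] ker by auto
      show "datum i w (c i + of_real (r i) * cis z) \<le> 1 - d" if "z \<in> {\<alpha><..<\<alpha> + \<eta>}" for z
        using walk_of[OF that] e0(2) eta(1) by (metis order_less_trans)
    qed
    also have "\<kappa> * d * (\<alpha> + \<eta> - \<alpha>) / (2 * pi) = b * d / (8 * pi * r i * r k)"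
      using u by (simp add: \<kappa>_def \<eta>_def field_simps)
    finally show "poisson (c i) (r i) (datum i w) x \<le> 1 - b * d / (8 * pi * r i * r k)" .
  qed
qed

lemma uniform_gap_finite:
  fixes f :: "'a \<Rightarrow> 'b \<Rightarrow> real"
  assumes "finite A" "\<And>a. a \<in> A \<Longrightarrow> \<exists>e>0. \<forall>x\<in>B a. f a x \<le> 1 - e"
  shows "\<exists>e>0. \<forall>a\<in>A. \<forall>x\<in>B a. f a x \<le> 1 - e"
  using assms
proof (induction A rule: finite_induct)
  case empty
  show ?case
    by (intro exI[of _ 1]) simp
next
  case (insert a A)
  obtain d where d: "d > 0" "\<forall>x\<in>B a. f a x \<le> 1 - d"
    using insert.prems[of a] by auto
  obtain e where e: "e > 0" "\<forall>a\<in>A. \<forall>x\<in>B a. f a x \<le> 1 - e"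
    using insert.IH insert.prems by auto
  show ?case
    using d e by (intro exI[of _ "min d e"]) fastforce
qed

text \<open>
  Points inside disk \<open>i\<close> have a neighbourhood with a gap by continuity, the end points of the arc
  by the estimate at a crossing; finitely many of these neighbourhoods cover the closed arc.
\<close>
lemma majorant_gap_on_circle:
  assumes i: "i \<in> {1..N}" and k: "k \<in> nbrs i"
  shows "\<exists>e>0. \<forall>x\<in>frontier (disk k) \<inter> disk i. majorant (Suc num_layers) i x \<le> 1 - e"
proof -
  have kN: "k \<in> {1..N}"
    by (rule subsetD[OF nbrs_subset k])
  let ?K = "frontier (disk k) \<inter> closure (disk i)"
  let ?S = "frontier (disk k) \<inter> disk i"
  let ?u = "majorant (Suc num_layers) i"
  have "\<exists>V. open V \<and> z \<in> V \<and> (\<exists>e>0. \<forall>x\<in>V \<inter> ?S. ?u x \<le> 1 - e)" if z: "z \<in> ?K" for z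
  proof (cases "z \<in> disk i")
    case True
    have "?u z < 1"
      using majorant_num_layers_less_1[OF i True, of "Suc num_layers"] by simp
    then obtain q where q: "?u z < q" "q < 1"
      using dense by blast
    have "(?u \<longlongrightarrow> ?u z) (at z within disk i)"
      using admissibleD(1)[OF admissible_majorant i] True unfolding continuous_on_def by blast
    from order_tendstoD(2)[OF this q(1)]
    obtain V where V: "open V" "z \<in> V" "\<And>x. x \<in> V \<Longrightarrow> x \<noteq> z \<Longrightarrow> x \<in> disk i \<Longrightarrow> ?u x < q"
      unfolding eventually_at_topological by blast
    have "\<forall>x\<in>V \<inter> ?S. ?u x \<le> 1 - (1 - q)"
      using V(3) q(1) by (metis Int_iff diff_diff_eq2 add_diff_cancel_left' less_imp_le)
    then show ?thesis
      using V(1,2) q(2) by (intro exI[of _ V]) (auto intro!: exI[of _ "1 - q"])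
  next
    case False
    then have "z \<in> frontier (disk i)" "z \<in> frontier (disk k)"
      using z unfolding frontier_def interior_open[OF open_disk] by auto
    from poisson_gap_near_crossing[OF i k admissible_majorant majorant_num_layers_less_1[OF _ _ order_refl] this]
    obtain V e where "open V" "z \<in> V" "0 < e"
      "\<And>x. x \<in> V \<Longrightarrow> x \<in> frontier (disk k) \<Longrightarrow> x \<in> disk i \<Longrightarrow>
        poisson (c i) (r i) (datum i (majorant num_layers)) x \<le> 1 - e"
      by metis
    then show ?thesis
      by (intro exI[of _ V]) (auto intro!: exI[of _ e])
  qed
  then obtain V where V: "\<And>z. z \<in> ?K \<Longrightarrow> open (V z)" "\<And>z. z \<in> ?K \<Longrightarrow> z \<in> V z"
      "\<And>z. z \<in> ?K \<Longrightarrow> \<exists>e>0. \<forall>x\<in>V z \<inter> ?S. ?u x \<le> 1 - e"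
    by metis
  have "compact ?K"
    unfolding frontier_disk[OF kN] by (intro compact_Int_closed) auto
  moreover have "?K \<subseteq> (\<Union>z\<in>?K. V z)"
    using V(2) by blast
  ultimately obtain C where C: "C \<subseteq> ?K" "finite C" "?K \<subseteq> (\<Union>z\<in>C. V z)"
    using V(1) by (metis compactE_image)
  obtain e where e: "e > 0" "\<forall>z\<in>C. \<forall>x\<in>V z \<inter> ?S. ?u x \<le> 1 - e"
    using uniform_gap_finite[OF C(2), of "\<lambda>z. V z \<inter> ?S" "\<lambda>_. ?u"] V(3) C(1) by blast
  have "?S \<subseteq> ?K"
    using closure_subset by blast
  then have "\<forall>x\<in>?S. ?u x \<le> 1 - e"
    using C(3) e(2) by blast
  then show ?thesis
    using e(1) by blast
qed

lemma majorant_uniform_gap: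
  "\<exists>e>0. \<forall>i\<in>{1..N}. \<forall>k\<in>nbrs i. \<forall>x\<in>frontier (disk k) \<inter> disk i. majorant (Suc num_layers) i x \<le> 1 - e"
proof -
  have "finite (Sigma {1..N} nbrs)"
    by (intro finite_SigmaI) auto
  from uniform_gap_finite[OF this, of "\<lambda>(i, k). frontier (disk k) \<inter> disk i" "\<lambda>(i, k). majorant (Suc num_layers) i"]
  show ?thesis
    using majorant_gap_on_circle by (auto simp: split_beta)
qed

end

section \<open>Domination of the iterates\<close>

text \<open>
  If \<open>g\<close> is not Borel, then neither is its product with the positive kernel, and the integral takes
  the default value 0. So every image under \<open>T\<close> is measurable on the skeletons, and its essential
  supremum is not the default value infinity.
\<close>
lemma borel_measurable_poisson_on_ball:
  assumes g: "\<And>y. y \<notin> sphere a \<rho> \<Longrightarrow> g y = 0"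
  shows "(\<lambda>x. indicator (ball a \<rho>) x * poisson a \<rho> g x) \<in> borel_measurable borel"
proof (cases "g \<in> borel_measurable borel")
  case True
  note [measurable] = this
  interpret finite_measure "circle_arclength a \<rho>"
    by (rule finite_measure_circle_arclength)
  have [measurable]: "(\<lambda>(x, y). poisson_kernel a \<rho> x y * g y) \<in> borel_measurable (borel \<Otimes>\<^sub>M circle_arclength a \<rho>)"
    unfolding poisson_kernel_def by measurable
  have "(\<lambda>x. LINT y|circle_arclength a \<rho>. poisson_kernel a \<rho> x y * g y) \<in> borel_measurable borel"
    by (rule borel_measurable_lebesgue_integral) simp
  moreover have "indicator (ball a \<rho>) \<in> borel_measurable borel"
    by (intro borel_measurable_indicator borel_open open_ball)
  ultimately show ?thesis
    unfolding poisson_def by (intro borel_measurable_times borel_measurable_const)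
next
  case False
  have "indicator (ball a \<rho>) x * poisson a \<rho> g x = 0" for x
  proof (cases "x \<in> ball a \<rho>")
    case True
    have "(\<lambda>y. poisson_kernel a \<rho> x y * g y) \<notin> borel_measurable borel"
    proof
      assume [measurable]: "(\<lambda>y. poisson_kernel a \<rho> x y * g y) \<in> borel_measurable borel"
      have "g = (\<lambda>y. (poisson_kernel a \<rho> x y * g y) / poisson_kernel a \<rho> x y)"
      proof
        fix y
        show "g y = poisson_kernel a \<rho> x y * g y / poisson_kernel a \<rho> x y"
          using g[of y] poisson_kernel_pos[OF True, of y] by (cases "y \<in> sphere a \<rho>") auto
      qed
      moreover have "(\<lambda>y. (poisson_kernel a \<rho> x y * g y) / poisson_kernel a \<rho> x y) \<in> borel_measurable borel"
        by measurable
      ultimately show False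
        using False by simp
    qed
    then have "\<not> integrable (circle_arclength a \<rho>) (\<lambda>y. poisson_kernel a \<rho> x y * g y)"
      by (auto dest!: borel_measurable_integrable cong: measurable_cong_sets)
    then show ?thesis
      by (simp add: poisson_def not_integrable_integral_eq)
  qed simp
  then show ?thesis
    by (simp only: borel_measurable_const)
qed

context disk_domain
begin

lemma AE_arclength_all_imp:
  assumes "AE x in arclength_all. Q x" "i \<in> {1..N}"
  shows "AE x in arclength i. Q x"
proof -
  obtain M where M: "{x \<in> space arclength_all. \<not> Q x} \<subseteq> M" "M \<in> sets arclength_all" "emeasure arclength_all M = 0"
    using assms(1) by (rule AE_E)
  have "(\<Sum>k\<in>{1..N}. emeasure (arclength k) M) = 0"
    using M by (simp add: emeasure_arclength_all)
  then have "emeasure (arclength i) M = 0"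
    using assms(2) by (simp add: sum_eq_0_iff)
  then show ?thesis
    using M by (intro AE_I[of _ _ M]) auto
qed

lemma AE_arclength_all_off_crossings: "AE x in arclength_all. x \<notin> crossings"
proof (rule AE_I)
  have cr: "crossings \<in> sets borel"
    using finite_crossings by (intro borel_closed finite_imp_closed)
  have "emeasure (arclength k) crossings = 0" if "k \<in> {1..N}" for k
  proof -
    have "AE y in arclength k. y \<notin> crossings"
      unfolding arclength_def by (rule AE_circle_arclength_notin_finite[OF r_pos[OF that] finite_crossings])
    then show ?thesis
      using cr by (subst (asm) AE_iff_measurable[of crossings]) auto
  qed
  then show "emeasure arclength_all crossings = 0"
    using cr by (simp add: emeasure_arclength_all)
  show "crossings \<in> sets arclength_all"
    using cr by simp
qed auto

lemma Skel_off_crossings: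
  assumes i: "i \<in> {1..N}" and x: "x \<in> Skel i" "x \<notin> crossings"
  obtains k where "k \<in> nbrs i" "x \<in> frontier (disk k) \<inter> disk i"
proof -
  obtain k where k: "k \<in> nbrs i" "x \<in> Skel2 i k"
    using x(1) by (auto simp: Skel_def)
  have kN: "k \<in> {1..N}"
    by (rule subsetD[OF nbrs_subset k(1)])
  have xk: "x \<in> frontier (disk k)" "x \<in> closure (disk i)"
    using Skel2_subset k(2) by auto
  then have "x \<in> disk i"
    using off_crossings[OF kN i _ xk(1) x(2)] nbrs_irrefl[OF k(1)] by auto
  then show ?thesis
    using that k(1) xk by blast
qed

end

context disk_partition_of_unity
begin

definition dominated :: "nat \<Rightarrow> (nat \<Rightarrow> complex \<Rightarrow> real) \<Rightarrow> bool" where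
  "dominated n v \<longleftrightarrow> (\<forall>i\<in>{1..N}. AE x in arclength_all. x \<in> Skel i \<longrightarrow> \<bar>v i x\<bar> \<le> majorant n i x)"

lemma T_in_disk:
  assumes "x \<in> Skel i" "x \<in> disk i"
  shows "T chi v i x =
    (\<Sum>j\<in>nbrs i. poisson (c i) (r i) (\<lambda>y. indicator (Skel2 j i) y * (v j y * chi i j y)) x)"
  using assms
  by (simp add: T_def P_def harm_ext_def poisson_def poisson_kernel_def arclength_def)

text \<open>
  The integrals of the operator and of the majorant are compared neighbour by neighbour. Almost
  every point of \<open>Skel2 j i\<close> lies in disk \<open>j\<close> and on the skeleton of disk \<open>j\<close>, where the bound on
  \<open>v j\<close> is available.
\<close>
lemma dominated_T_in_disk:
  assumes i: "i \<in> {1..N}" and v: "dominated n v" and x: "x \<in> Skel i" "x \<in> disk i"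
  shows "\<bar>T chi v i x\<bar> \<le> majorant (Suc n) i x"
proof -
  have ri: "0 < r i"
    by (rule r_pos[OF i])
  have xb: "x \<in> ball (c i) (r i)"
    using x(2) by (simp add: disk_def)
  let ?A = "circle_arclength (c i) (r i)"
  let ?K = "poisson_kernel (c i) (r i) x"
  define g where "g = (\<lambda>j y. indicator (Skel2 j i) y * (v j y * chi i j y))"
  define h where "h = (\<lambda>j y. indicator (frontier (disk i) \<inter> disk j) y * (chi i j y * majorant n j y))"
  have int_h: "integrable ?A (\<lambda>y. ?K y * h j y)" if j: "j \<in> nbrs i" for j
  proof (rule integrable_poisson_kernel_mult[OF xb], rule finite_measure.integrable_const_bound[OF finite_measure_circle_arclength])
    have jN: "j \<in> {1..N}"
      by (rule subsetD[OF nbrs_subset j])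
    show "h j \<in> borel_measurable ?A"
      using datum_term_measurable[OF i j admissible_majorant, of n] by (simp add: h_def cong: measurable_cong_sets)
    have "norm (h j y) \<le> 1" for y
    proof (cases "y \<in> frontier (disk i) \<inter> disk j")
      case True
      have "chi i l y \<ge> 0" if "l \<in> nbrs i" for l
        using chi_nonneg[OF i that _ _ jN] True by blast
      then have "0 \<le> chi i j y" "chi i j y \<le> (\<Sum>l\<in>nbrs i. chi i l y)"
        using j by (auto intro!: member_le_sum)
      moreover have "(\<Sum>l\<in>nbrs i. chi i l y) = 1"
        using chi_sum_in_disk[OF i _ _ jN] True by blast
      ultimately show ?thesis
        using True admissibleD(2,3)[OF admissible_majorant jN, of y n]
        by (auto simp: h_def abs_mult intro!: mult_le_one)
    qed (simp add: h_def)
    then show "AE y in ?A. norm (h j y) \<le> 1"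
      by simp
  qed
  have bound: "\<bar>poisson (c i) (r i) (g j) x\<bar> \<le> poisson (c i) (r i) (h j) x" if j: "j \<in> nbrs i" for j
  proof -
    have jN: "j \<in> {1..N}"
      by (rule subsetD[OF nbrs_subset j])
    have "AE y in arclength_all. y \<in> Skel j \<longrightarrow> \<bar>v j y\<bar> \<le> majorant n j y"
      using v jN by (auto simp: dominated_def)
    then have 1: "AE y in ?A. y \<in> Skel j \<longrightarrow> \<bar>v j y\<bar> \<le> majorant n j y"
      unfolding arclength_def[symmetric] by (rule AE_arclength_all_imp[OF _ i])
    have ae: "AE y in ?A. \<bar>?K y * g j y\<bar> \<le> ?K y * h j y"
      using 1 AE_circle_arclength_sphere[OF ri, of "c i"]
        AE_circle_arclength_notin_finite[OF ri finite_crossings, of "c i"]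
    proof eventually_elim
      case (elim y)
      have K: "0 < ?K y"
        by (rule poisson_kernel_pos[OF xb elim(2)])
      have yf: "y \<in> frontier (disk i)"
        using elim(2) frontier_disk[OF i] by blast
      have nonneg: "0 \<le> h j y"
        using chi_nonneg[OF i j yf _ jN] admissibleD(2)[OF admissible_majorant jN, of y n]
        by (auto simp: h_def indicator_def)
      have "\<bar>g j y\<bar> \<le> h j y"
      proof (cases "y \<in> Skel2 j i")
        case True
        then have "y \<in> Skel j"
          using nbrs_sym[OF j i] by (auto simp: Skel_def)
        moreover have "y \<in> disk j"
          using off_crossings[OF i jN nbrs_irrefl[OF j] yf elim(3)] Skel2_subset True by blast
        ultimately show ?thesis
          using elim(1) True yf mult_right_mono[of "\<bar>v j y\<bar>" "majorant n j y" "chi i j y"]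
            chi_nonneg[OF i j yf \<open>y \<in> disk j\<close> jN]
          by (simp add: g_def h_def abs_mult mult.commute)
      qed (use nonneg in \<open>simp add: g_def\<close>)
      then show ?case
        using K by (simp add: abs_mult)
    qed
    have "\<bar>LINT y|?A. ?K y * g j y\<bar> \<le> (LINT y|?A. \<bar>?K y * g j y\<bar>)"
      using integral_norm_bound[of ?A "\<lambda>y. ?K y * g j y"] by simp
    also have "\<dots> \<le> (LINT y|?A. ?K y * h j y)"
      using ae by (intro integral_mono_AE'[OF int_h[OF j]]) (auto elim!: eventually_mono)
    finally show ?thesis
      unfolding poisson_def using ri by (simp add: abs_mult divide_right_mono)
  qed
  have "\<bar>T chi v i x\<bar> \<le> (\<Sum>j\<in>nbrs i. \<bar>poisson (c i) (r i) (g j) x\<bar>)"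
    unfolding T_in_disk[OF x] g_def by (rule sum_abs)
  also have "\<dots> \<le> (\<Sum>j\<in>nbrs i. poisson (c i) (r i) (h j) x)"
    by (intro sum_mono bound)
  also have "\<dots> = 1 / (2 * pi * r i) * (LINT y|?A. (\<Sum>j\<in>nbrs i. ?K y * h j y))"
    unfolding poisson_def using int_h by (simp add: Bochner_Integration.integral_sum sum_distrib_left sum_divide_distrib)
  also have "\<dots> = majorant (Suc n) i x"
    by (simp only: majorant.simps poisson_def datum_def h_def sum_distrib_left)
  finally show ?thesis .
qed

lemma dominated_T:
  assumes "dominated n v"
  shows "dominated (Suc n) (T chi v)"
  unfolding dominated_def
proof
  fix i assume i: "i \<in> {1..N}"
  show "AE x in arclength_all. x \<in> Skel i \<longrightarrow> \<bar>T chi v i x\<bar> \<le> majorant (Suc n) i x"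
    using AE_arclength_all_off_crossings
  proof eventually_elim
    case (elim x)
    show ?case
      using Skel_off_crossings[OF i _ elim] dominated_T_in_disk[OF i assms, of x] by blast
  qed
qed

lemma dominated_funpow_T:
  assumes "dominated 0 v"
  shows "dominated n ((T chi ^^ n) v)"
  by (induction n) (use assms dominated_T in auto)

lemma measurable_T_on_Skel:
  assumes i: "i \<in> {1..N}"
  shows "T chi v i \<in> borel_measurable (restrict_space arclength_all (Skel i))"
proof -
  define g where "g = (\<lambda>j y. indicator (Skel2 j i) y * (v j y * chi i j y))"
  define f where "f = (\<lambda>x. \<Sum>j\<in>nbrs i. indicator (ball (c i) (r i)) x * poisson (c i) (r i) (g j) x)"
  have "g j y = 0" if "y \<notin> sphere (c i) (r i)" for j y
    using that Skel2_subset[of j i] unfolding frontier_disk[OF i] by (auto simp: g_def indicator_def)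
  then have "f \<in> borel_measurable borel"
    unfolding f_def by (intro borel_measurable_sum borel_measurable_poisson_on_ball)
  then have "f \<in> borel_measurable arclength_all"
    by (simp cong: measurable_cong_sets)
  then have "f \<in> borel_measurable (restrict_space arclength_all (Skel i))"
    by (rule measurable_restrict_space1)
  then show ?thesis
  proof (rule measurable_discrete_difference[where X = "crossings \<inter> Skel i"])
    show "countable (crossings \<inter> Skel i)"
      using finite_crossings by (auto intro: countable_finite)
    show "{x} \<in> sets (restrict_space arclength_all (Skel i))" if "x \<in> crossings \<inter> Skel i" for x
      using that by (auto simp: sets_restrict_space image_iff intro!: bexI[of _ "{x}"])
    show "f x = T chi v i x" if "x \<in> space (restrict_space arclength_all (Skel i))" "x \<notin> crossings \<inter> Skel i" for x
    proof -
      have x: "x \<in> Skel i" "x \<notin> crossings"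
        using that by (auto simp: space_restrict_space)
      then have "x \<in> disk i"
        using Skel_off_crossings[OF i x] by blast
      then show ?thesis
        using T_in_disk[OF x(1)] by (simp add: f_def g_def disk_def)
    qed
  qed simp
qed

lemma sup_norm_le_iff: "sup_norm v \<le> e \<longleftrightarrow>
    (\<forall>j\<in>{1..N}. esssup (restrict_space arclength_all (Skel j)) (\<lambda>x. ennreal \<bar>v j x\<bar>) \<le> e)"
  unfolding sup_norm_def using N_gt_1 by (subst Max_le_iff) auto

lemma AE_restrict_Skel:
  "(AE x in restrict_space arclength_all (Skel j). Q x) \<longleftrightarrow> (AE x in arclength_all. x \<in> Skel j \<longrightarrow> Q x)"
  using closed_Skel[of j] by (intro AE_restrict_space_iff) (simp add: borel_closed)

lemma dominated_0_of_sup_norm: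
  assumes "sup_norm v \<le> 1"
  shows "dominated 0 v"
  unfolding dominated_def
proof
  fix i assume i: "i \<in> {1..N}"
  have le: "esssup (restrict_space arclength_all (Skel i)) (\<lambda>x. ennreal \<bar>v i x\<bar>) \<le> 1"
    using assms i sup_norm_le_iff by blast
  have "AE x in restrict_space arclength_all (Skel i). \<bar>v i x\<bar> \<le> majorant 0 i x"
    using esssup_AE[of "\<lambda>x. ennreal \<bar>v i x\<bar>" "restrict_space arclength_all (Skel i)"]
  proof eventually_elim
    case (elim x)
    then have "ennreal \<bar>v i x\<bar> \<le> 1"
      using le by (rule order_trans)
    then show ?case
      by simp
  qed
  then show "AE x in arclength_all. x \<in> Skel i \<longrightarrow> \<bar>v i x\<bar> \<le> majorant 0 i x"
    by (simp only: AE_restrict_Skel)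
qed

lemma op_norm_funpow_T_less_1: "op_norm (T chi ^^ (num_layers + 1)) < 1"
proof -
  obtain e where e: "e > 0" "\<And>i k x. i \<in> {1..N} \<Longrightarrow> k \<in> nbrs i \<Longrightarrow> x \<in> frontier (disk k) \<inter> disk i \<Longrightarrow>
      majorant (Suc num_layers) i x \<le> 1 - e"
    using majorant_uniform_gap by blast
  have "sup_norm ((T chi ^^ (num_layers + 1)) v) \<le> ennreal (1 - e)" if v: "sup_norm v = 1" for v
    unfolding sup_norm_le_iff
  proof (intro ballI esssup_I)
    fix i assume i: "i \<in> {1..N}"
    have dom: "AE x in arclength_all. x \<in> Skel i \<longrightarrow> \<bar>(T chi ^^ (num_layers + 1)) v i x\<bar> \<le> majorant (num_layers + 1) i x"
      using dominated_funpow_T[OF dominated_0_of_sup_norm[OF eq_refl[OF v]], of "num_layers + 1"] i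
      unfolding dominated_def by blast
    show "AE x in restrict_space arclength_all (Skel i).
        ennreal \<bar>(T chi ^^ (num_layers + 1)) v i x\<bar> \<le> ennreal (1 - e)"
      unfolding AE_restrict_Skel using dom AE_arclength_all_off_crossings
    proof eventually_elim
      case (elim x)
      show ?case
      proof
        assume x: "x \<in> Skel i"
        obtain k where "k \<in> nbrs i" "x \<in> frontier (disk k) \<inter> disk i"
          by (rule Skel_off_crossings[OF i x elim(2)])
        then show "ennreal \<bar>(T chi ^^ (num_layers + 1)) v i x\<bar> \<le> ennreal (1 - e)"
          using e(2)[OF i, of k x] elim(1) x by (intro ennreal_leI) simp
      qed
    qed
    have "(T chi ^^ (num_layers + 1)) v i = T chi ((T chi ^^ num_layers) v) i"
      by simp
    then have [measurable]: "(T chi ^^ (num_layers + 1)) v i \<in> borel_measurable (restrict_space arclength_all (Skel i))"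
      using measurable_T_on_Skel[OF i] by simp
    show "(\<lambda>x. ennreal \<bar>(T chi ^^ (num_layers + 1)) v i x\<bar>) \<in> borel_measurable (restrict_space arclength_all (Skel i))"
      by measurable
  qed
  then have "op_norm (T chi ^^ (num_layers + 1)) \<le> ennreal (1 - e)"
    unfolding op_norm_def by (intro SUP_least) auto
  also have "ennreal (1 - e) < 1"
    using e(1) by (simp add: ennreal_less_one_iff)
  finally show ?thesis .
qed

end

theorem corollary2p11:
  fixes N :: nat and c :: "nat \<Rightarrow> complex" and r :: "nat \<Rightarrow> real"
    and chi :: "nat \<Rightarrow> nat \<Rightarrow> complex \<Rightarrow> real"
  assumes "disk_partition_of_unity N c r chi"
  shows "disk_family.op_norm N c r
           (disk_family.T N c r chi ^^ (disk_family.num_layers N c r + 1)) < 1"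
  using disk_partition_of_unity.op_norm_funpow_T_less_1[OF assms] .

end
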